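(* Let $\Gamma$ be a metric graph. Suppose $\Sigma\subseteq R(D)$ is a tropical linear series and $D\in|\Sigma|$ is nondegenerate. Then, for all $\varphi\in\Sigma$, the set $\varphi_{\min}$ contains no isolated points.
   Context: A metric graph is the metric space of a finite connected graph (loops and multiple edges allowed) with positive real edge lengths; the valence of a point is its number of tangent directions (at least 1). A divisor $D$ is a finite formal $\mathbb Z$-combination of points; effective ($\ge0$) means all coefficients are nonnegative; $\mathrm{supp}(D)$ is the set of points with nonzero coefficient. $\mathrm{PL}(\Gamma)$ is the set of continuous piecewise-linear functions with integer slopes; $\mathrm{div}(\varphi)$ has multiplicity at $p$ the sum of the incoming slopes (minus the sum of the outgoing slopes) of $\varphi$ at $p$; $R(D)=\{\varphi\in\mathrm{PL}(\Gamma):D+\mathrm{div}(\varphi)\ge0\}$. A tropical submodule of $R(D)$ is a subset closed under pointwise minimum and addition of real constants (a zero element $\infty$ is tacitly adjoined and excluded here); it is finitely generated if it consists of all finite combinations $\min_i\{\varphi_i+a_i\}$ of a finite set. $r_{\mathrm{BN}}(\Sigma)$ is the largest integer $r$ such that for every effective $D'$ of degree $r$ there is $\varphi\in\Sigma$ with $D-D'+\mathrm{div}(\varphi)\ge0$. A finite set $\{\varphi_0,\dots,\varphi_s\}$ is tropically dependent if there are reals $a_i$ such that at every point of $\Gamma$ the minimum $\min_i\{\varphi_i+a_i\}$ is achieved at least twice, and independent otherwise; $r_{\mathrm{ind}}(\Sigma)$ is the size of the largest independent subset. A tropical linear series is a finitely generated $\Sigma\subseteq R(D)$ with $r_{\mathrm{ind}}(\Sigma)=r_{\mathrm{BN}}(\Sigma)+1$.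 $|\Sigma|=\{D+\mathrm{div}(\varphi):\varphi\in\Sigma\}$, topologized as a subset of $\mathrm{Sym}^d(\Gamma)=\Gamma^d/S_d$, $d=\deg D$. The valence 1 degree of a divisor is the sum of its multiplicities at the valence 1 points of $\Gamma$. $D\in|\Sigma|$ is nondegenerate if $\#\mathrm{supp}$ has a local maximum on $|\Sigma|$ at $D$ and the valence 1 degree has a local minimum on $|\Sigma|$ at $D$. $\varphi_{\min}=\{p\in\Gamma:\varphi(p)=\min_\Gamma\varphi\}$. *)

theory Defs
  imports
    "Graph_Theory.Digraph_Component"
    "HOL-Analysis.Analysis"
    "HOL-Library.Extended_Nat"
begin

section \<open>Metric graphs\<close>

text \<open>
  A model of a metric graph is a finite connected multigraph (loops and parallel edges allowed) with
  positive edge lengths. The orientation of the arcs only serves to put a coordinate on each edge;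
  connectedness is that of the underlying undirected graph. The one-point graph is excluded, since
  every point is required to have valence at least 1.
\<close>

record ('v, 'e) metric_graph =
  model :: "('v, 'e) pre_digraph"
  len :: "'e \<Rightarrow> real"

abbreviation edges :: "('v, 'e) metric_graph \<Rightarrow> 'e set" where
  "edges \<Gamma> \<equiv> arcs (model \<Gamma>)"

definition is_metric_graph :: "('v, 'e) metric_graph \<Rightarrow> bool" where
  "is_metric_graph \<Gamma> \<longleftrightarrow>
     fin_digraph (model \<Gamma>) \<and> Digraph_Component.connected (model \<Gamma>) \<and>
     edges \<Gamma> \<noteq> {} \<and> (\<forall>e\<in>edges \<Gamma>. 0 < len \<Gamma> e)"

datatype ('v, 'e) point = Vertex 'v | Inner 'e real

definition points :: "('v, 'e) metric_graph \<Rightarrow> ('v, 'e) point set" where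
  "points \<Gamma> = Vertex ` verts (model \<Gamma>) \<union> {Inner e x | e x. e \<in> edges \<Gamma> \<and> 0 < x \<and> x < len \<Gamma> e}"

text \<open>\<open>pt \<Gamma> e\<close> parametrises the closed edge \<open>e\<close> by the interval \<open>{0..len \<Gamma> e}\<close>.\<close>

definition pt :: "('v, 'e) metric_graph \<Rightarrow> 'e \<Rightarrow> real \<Rightarrow> ('v, 'e) point" where
  "pt \<Gamma> e x =
     (if x = 0 then Vertex (tail (model \<Gamma>) e)
      else if x = len \<Gamma> e then Vertex (head (model \<Gamma>) e)
      else Inner e x)"

text \<open>
  Paths are concatenations of segments; the segment \<open>(e, x, y)\<close> runs inside the closed edge \<open>e\<close> from
  coordinate \<open>x\<close> to coordinate \<open>y\<close>.
\<close>

fun is_path ::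
  "('v, 'e) metric_graph \<Rightarrow> ('v, 'e) point \<Rightarrow> ('e \<times> real \<times> real) list \<Rightarrow> ('v, 'e) point \<Rightarrow> bool"
where
  "is_path \<Gamma> p [] q \<longleftrightarrow> p = q"
| "is_path \<Gamma> p ((e, x, y) # c) q \<longleftrightarrow>
     e \<in> edges \<Gamma> \<and> x \<in> {0..len \<Gamma> e} \<and> y \<in> {0..len \<Gamma> e} \<and> p = pt \<Gamma> e x \<and> is_path \<Gamma> (pt \<Gamma> e y) c q"

definition path_length :: "('e \<times> real \<times> real) list \<Rightarrow> real" where
  "path_length c = (\<Sum>(e, x, y)\<leftarrow>c. \<bar>x - y\<bar>)"

text \<open>The value 0 off \<^term>\<open>points \<Gamma>\<close> is irrelevant, but \<^locale>\<open>Metric_space\<close> wants a total function.\<close>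

definition graph_dist ::
  "('v, 'e) metric_graph \<Rightarrow> ('v, 'e) point \<Rightarrow> ('v, 'e) point \<Rightarrow> real" where
  "graph_dist \<Gamma> p q =
     (if p \<in> points \<Gamma> \<and> q \<in> points \<Gamma> then Inf {path_length c | c. is_path \<Gamma> p c q} else 0)"

definition graph_topology :: "('v, 'e) metric_graph \<Rightarrow> ('v, 'e) point topology" where
  "graph_topology \<Gamma> = Metric_space.mtopology (points \<Gamma>) (graph_dist \<Gamma>)"

lemma is_path_append:
  "is_path \<Gamma> p c q \<Longrightarrow> is_path \<Gamma> q c' r \<Longrightarrow> is_path \<Gamma> p (c @ c') r"
  by (induction \<Gamma> p c q rule: is_path.induct) auto

lemma path_length_simps [simp]:
  "path_length [] = 0"
  "path_length ((e, x, y) # c) = \<bar>x - y\<bar> + path_length c"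
  "path_length (c @ c') = path_length c + path_length c'"
  by (simp_all add: path_length_def)

lemma path_length_nonneg: "0 \<le> path_length c"
  by (induction c) auto

lemma is_path_reverse:
  "is_path \<Gamma> p c q \<Longrightarrow> \<exists>c'. is_path \<Gamma> q c' p \<and> path_length c' = path_length c"
proof (induction \<Gamma> p c q rule: is_path.induct)
  case (1 \<Gamma> p q)
  then have "is_path \<Gamma> q [] p" by simp
  then show ?case by (metis path_length_simps(1))
next
  case (2 \<Gamma> p e x y c q)
  then obtain c' where c': "is_path \<Gamma> q c' (pt \<Gamma> e y)" "path_length c' = path_length c"
    by auto
  have "is_path \<Gamma> (pt \<Gamma> e y) [(e, y, x)] p"
    using 2 by auto
  then show ?case
    using is_path_append[OF c'(1)] c'(2) by (intro exI[of _ "c' @ [(e, y, x)]"]) auto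
qed

lemma is_path_Lipschitz:
  fixes f :: "('v, 'e) point \<Rightarrow> real"
  assumes "\<And>e x y. \<lbrakk>e \<in> edges \<Gamma>; x \<in> {0..len \<Gamma> e}; y \<in> {0..len \<Gamma> e}\<rbrakk> \<Longrightarrow>
      \<bar>f (pt \<Gamma> e x) - f (pt \<Gamma> e y)\<bar> \<le> \<bar>x - y\<bar>"
  shows "is_path \<Gamma> p c q \<Longrightarrow> \<bar>f p - f q\<bar> \<le> path_length c"
proof (induction c arbitrary: p)
  case (Cons s c)
  obtain e x y where s: "s = (e, x, y)" by (cases s)
  with Cons have "\<bar>f (pt \<Gamma> e y) - f q\<bar> \<le> path_length c" "\<bar>f p - f (pt \<Gamma> e y)\<bar> \<le> \<bar>x - y\<bar>"
    using assms by auto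
  with s show ?case by auto
qed auto

lemma separating_function:
  fixes \<Gamma> :: "('v, 'e) metric_graph"
  assumes \<Gamma>: "is_metric_graph \<Gamma>" and p: "p \<in> points \<Gamma>" and q: "q \<in> points \<Gamma>" and "p \<noteq> q"
  shows "\<exists>f::('v, 'e) point \<Rightarrow> real. f p \<noteq> f q \<and>
    (\<forall>e\<in>edges \<Gamma>. \<forall>x\<in>{0..len \<Gamma> e}. \<forall>y\<in>{0..len \<Gamma> e}.
       \<bar>f (pt \<Gamma> e x) - f (pt \<Gamma> e y)\<bar> \<le> \<bar>x - y\<bar>)"
proof -
  have inner: "\<exists>f::('v, 'e) point \<Rightarrow> real. f p \<noteq> f q \<and>
      (\<forall>e\<in>edges \<Gamma>. \<forall>x\<in>{0..len \<Gamma> e}. \<forall>y\<in>{0..len \<Gamma> e}.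
         \<bar>f (pt \<Gamma> e x) - f (pt \<Gamma> e y)\<bar> \<le> \<bar>x - y\<bar>)"
    if h: "p = Inner d a" "d \<in> edges \<Gamma>" "0 < a" "a < len \<Gamma> d" "p \<noteq> q"
    for p q :: "('v, 'e) point" and d a
  proof -
    define s where "s = (case q of Vertex v \<Rightarrow> 1 | Inner e b \<Rightarrow> if e = d then \<bar>b - a\<bar> else 1)"
    define r where "r = min s (min a (len \<Gamma> d - a))"
    have "r > 0" using h by (auto simp: r_def s_def split: point.splits)
    define f where "f = (\<lambda>z::('v,'e) point. case z of Vertex v \<Rightarrow> 0 | Inner e b \<Rightarrow>
      if e = d then max 0 (r - \<bar>b - a\<bar>) else (0::real))"
    have fpt: "f (pt \<Gamma> e x) = (if e = d then max 0 (r - \<bar>x - a\<bar>) else 0)"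
      if "x \<in> {0..len \<Gamma> e}" for e x
      using that h by (auto simp: f_def pt_def r_def)
    have "f p = r" using h \<open>r > 0\<close> by (simp add: f_def)
    moreover have "f q = 0" by (auto simp: f_def r_def s_def split: point.splits)
    moreover have "\<bar>f (pt \<Gamma> e x) - f (pt \<Gamma> e y)\<bar> \<le> \<bar>x - y\<bar>"
      if "x \<in> {0..len \<Gamma> e}" "y \<in> {0..len \<Gamma> e}" for e x y
      using that by (auto simp: fpt)
    ultimately have "f p \<noteq> f q \<and>
      (\<forall>e\<in>edges \<Gamma>. \<forall>x\<in>{0..len \<Gamma> e}. \<forall>y\<in>{0..len \<Gamma> e}.
         \<bar>f (pt \<Gamma> e x) - f (pt \<Gamma> e y)\<bar> \<le> \<bar>x - y\<bar>)"
      using \<open>r > 0\<close> by auto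
    then show ?thesis by blast
  qed
  consider d a where "p = Inner d a" "d \<in> edges \<Gamma>" "0 < a" "a < len \<Gamma> d"
    | d a where "q = Inner d a" "d \<in> edges \<Gamma>" "0 < a" "a < len \<Gamma> d"
    | v w where "p = Vertex v" "q = Vertex w"
    using p q by (auto simp: points_def)
  then show ?thesis
  proof cases
    case 1
    with inner \<open>p \<noteq> q\<close> show ?thesis by blast
  next
    case 2
    with inner[of q d a p] \<open>p \<noteq> q\<close> obtain f :: "('v, 'e) point \<Rightarrow> real" where
      "f q \<noteq> f p" "\<forall>e\<in>edges \<Gamma>. \<forall>x\<in>{0..len \<Gamma> e}. \<forall>y\<in>{0..len \<Gamma> e}.
         \<bar>f (pt \<Gamma> e x) - f (pt \<Gamma> e y)\<bar> \<le> \<bar>x - y\<bar>" by auto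
    then show ?thesis by (intro exI[of _ f]) auto
  next
    case 3
    have fin: "finite (edges \<Gamma>)" and ne: "edges \<Gamma> \<noteq> {}" and pos: "\<forall>e\<in>edges \<Gamma>. 0 < len \<Gamma> e"
      using \<Gamma> by (auto simp: is_metric_graph_def fin_digraph.finite_arcs)
    define r where "r = Min (len \<Gamma> ` edges \<Gamma>) / 2"
    have "r > 0" using fin ne pos by (auto simp: r_def)
    have r: "2 * r \<le> len \<Gamma> e" if "e \<in> edges \<Gamma>" for e
      using fin that by (auto simp: r_def)
    define g where "g = (\<lambda>e x. max 0 (max
      (if tail (model \<Gamma>) e = v then r - x else 0)
      (if head (model \<Gamma>) e = v then r - (len \<Gamma> e - x) else (0::real))))"
    define f where "f = (\<lambda>z::('v,'e) point. case z of Vertex u \<Rightarrow> (if u = v then r else 0)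
      | Inner e b \<Rightarrow> g e b)"
    have fpt: "f (pt \<Gamma> e x) = g e x" if "e \<in> edges \<Gamma>" "x \<in> {0..len \<Gamma> e}" for e x
      using that r[of e] \<open>r > 0\<close> by (auto simp: f_def g_def pt_def)
    have "\<bar>f (pt \<Gamma> e x) - f (pt \<Gamma> e y)\<bar> \<le> \<bar>x - y\<bar>"
      if "e \<in> edges \<Gamma>" "x \<in> {0..len \<Gamma> e}" "y \<in> {0..len \<Gamma> e}" for e x y
      using that r[of e] \<open>r > 0\<close> by (auto simp: fpt g_def)
    moreover have "f p \<noteq> f q"
      using 3 \<open>p \<noteq> q\<close> \<open>r > 0\<close> by (auto simp: f_def)
    ultimately show ?thesis by (intro exI[of _ f]) auto
  qed
qed

lemma path_connected_points:
  assumes \<Gamma>: "is_metric_graph \<Gamma>" and p: "p \<in> points \<Gamma>" and q: "q \<in> points \<Gamma>"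
  shows "\<exists>c. is_path \<Gamma> p c q"
proof -
  interpret fin_digraph "model \<Gamma>" using \<Gamma> by (simp add: is_metric_graph_def)
  have pos: "0 < len \<Gamma> e" if "e \<in> edges \<Gamma>" for e
    using \<Gamma> that by (simp add: is_metric_graph_def)
  have step: "\<exists>c. is_path \<Gamma> (pt \<Gamma> e x) c (pt \<Gamma> e y)"
    if "e \<in> edges \<Gamma>" "x \<in> {0..len \<Gamma> e}" "y \<in> {0..len \<Gamma> e}" for e x y
    using that by (intro exI[of _ "[(e, x, y)]"]) auto
  have trans: "\<exists>c. is_path \<Gamma> a c d" if "\<exists>c. is_path \<Gamma> a c b" "\<exists>c. is_path \<Gamma> b c d" for a b d
    using that is_path_append by blast
  have edge: "\<exists>c. is_path \<Gamma> (Vertex u) c (Vertex v)"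
    if "(u, v) \<in> parcs (mk_symmetric (model \<Gamma>))" for u v
  proof -
    obtain e where e: "e \<in> edges \<Gamma>"
      and uv: "(u, v) = (tail (model \<Gamma>) e, head (model \<Gamma>) e) \<or>
               (u, v) = (head (model \<Gamma>) e, tail (model \<Gamma>) e)"
      using \<open>(u, v) \<in> parcs _\<close> by (auto simp: mk_symmetric_def)
    then show ?thesis
      using step[OF e, of 0 "len \<Gamma> e"] step[OF e, of "len \<Gamma> e" 0] pos[OF e]
      by (auto simp: pt_def split: if_splits)
  qed
  have conn: "u \<rightarrow>\<^sup>*\<^bsub>with_proj (mk_symmetric (model \<Gamma>))\<^esub> v"
    if "u \<in> verts (model \<Gamma>)" "v \<in> verts (model \<Gamma>)" for u v
    using \<Gamma> that by (auto simp: is_metric_graph_def Digraph_Component.connected_def strongly_connected_def)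
  have "\<exists>c. is_path \<Gamma> (Vertex u) c (Vertex v)"
    if "u \<rightarrow>\<^sup>*\<^bsub>with_proj (mk_symmetric (model \<Gamma>))\<^esub> v" for u v
    using that unfolding reachable_def
  proof (induction rule: rtrancl_on.induct)
    case (rtrancl_on_refl a)
    have "is_path \<Gamma> (Vertex a) [] (Vertex a)" by simp
    then show ?case by blast
  next
    case (rtrancl_on_into_rtrancl_on a b c)
    then show ?case using trans edge by (auto simp: arcs_ends_def arc_to_ends_def)
  qed
  then have vv: "\<exists>c. is_path \<Gamma> (Vertex u) c (Vertex v)"
    if "u \<in> verts (model \<Gamma>)" "v \<in> verts (model \<Gamma>)" for u v
    using conn that by blast
  have to_vertex: "\<exists>u\<in>verts (model \<Gamma>). \<exists>c. is_path \<Gamma> z c (Vertex u)" if "z \<in> points \<Gamma>" for z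
    using that unfolding points_def
  proof (elim UnE imageE CollectE exE conjE)
    fix u assume "z = Vertex u" "u \<in> verts (model \<Gamma>)"
    moreover from this have "is_path \<Gamma> z [] (Vertex u)" by simp
    ultimately show ?thesis by blast
  next
    fix e x assume "z = Inner e x" "e \<in> edges \<Gamma>" "0 < x" "x < len \<Gamma> e"
    then show ?thesis using step[of e x 0]
      by (intro bexI[of _ "tail (model \<Gamma>) e"]) (auto simp: pt_def)
  qed
  obtain u where u: "u \<in> verts (model \<Gamma>)" "\<exists>c. is_path \<Gamma> p c (Vertex u)"
    using to_vertex[OF p] by blast
  obtain v where v: "v \<in> verts (model \<Gamma>)" "\<exists>c. is_path \<Gamma> q c (Vertex v)"
    using to_vertex[OF q] by blast
  from v(2) have "\<exists>c. is_path \<Gamma> (Vertex v) c q" using is_path_reverse by blast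
  with u v(1) vv show ?thesis using trans by blast
qed

lemma Metric_space_graph:
  assumes \<Gamma>: "is_metric_graph \<Gamma>"
  shows "Metric_space (points \<Gamma>) (graph_dist \<Gamma>)"
proof
  let ?L = "\<lambda>p q. {path_length c | c. is_path \<Gamma> p c q}"
  have bdd: "bdd_below (?L p q)" for p q
    using path_length_nonneg by (auto intro!: bdd_belowI[of _ 0])
  have ne: "?L p q \<noteq> {}" if "p \<in> points \<Gamma>" "q \<in> points \<Gamma>" for p q
    using path_connected_points[OF \<Gamma> that] by blast
  show "0 \<le> graph_dist \<Gamma> p q" for p q
    unfolding graph_dist_def using ne[of p q] path_length_nonneg
    by (auto intro!: cInf_greatest simp del: Collect_empty_eq)
  have "?L p q = ?L q p" for p q
    by (auto dest: is_path_reverse) (metis is_path_reverse)+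
  then show "graph_dist \<Gamma> p q = graph_dist \<Gamma> q p" for p q
    by (simp add: graph_dist_def)
  have le: "graph_dist \<Gamma> p q \<le> path_length c"
    if "is_path \<Gamma> p c q" "p \<in> points \<Gamma>" "q \<in> points \<Gamma>" for p q c
    using that bdd by (auto simp: graph_dist_def intro!: cInf_lower)
  have ge: "b \<le> graph_dist \<Gamma> p q"
    if "\<And>c. is_path \<Gamma> p c q \<Longrightarrow> b \<le> path_length c" "p \<in> points \<Gamma>" "q \<in> points \<Gamma>" for p q b
    using that ne[of p q]
    by (auto simp: graph_dist_def simp del: Collect_empty_eq intro!: cInf_greatest)
  show "graph_dist \<Gamma> p q = 0 \<longleftrightarrow> p = q" if pq: "p \<in> points \<Gamma>" "q \<in> points \<Gamma>" for p q
  proof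
    assume "p = q"
    then show "graph_dist \<Gamma> p q = 0"
      using le[of p "[]" q] pq \<open>\<And>q p. 0 \<le> graph_dist \<Gamma> p q\<close> by (simp add: order_antisym)
  next
    assume 0: "graph_dist \<Gamma> p q = 0"
    show "p = q"
    proof (rule ccontr)
      assume "p \<noteq> q"
      then obtain f :: "('a, 'b) point \<Rightarrow> real" where f: "f p \<noteq> f q"
        "\<forall>e\<in>edges \<Gamma>. \<forall>x\<in>{0..len \<Gamma> e}. \<forall>y\<in>{0..len \<Gamma> e}.
           \<bar>f (pt \<Gamma> e x) - f (pt \<Gamma> e y)\<bar> \<le> \<bar>x - y\<bar>"
        using separating_function[OF \<Gamma> pq] by blast
      then have "\<bar>f p - f q\<bar> \<le> path_length c" if "is_path \<Gamma> p c q" for c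
        using is_path_Lipschitz[OF _ that, of f] by blast
      then have "\<bar>f p - f q\<bar> \<le> graph_dist \<Gamma> p q"
        by (intro ge pq)
      with 0 f show False by simp
    qed
  qed
  show "graph_dist \<Gamma> p r \<le> graph_dist \<Gamma> p q + graph_dist \<Gamma> q r"
    if pqr: "p \<in> points \<Gamma>" "q \<in> points \<Gamma>" "r \<in> points \<Gamma>" for p q r
  proof -
    have "graph_dist \<Gamma> p r \<le> path_length c + path_length c'"
      if "is_path \<Gamma> p c q" "is_path \<Gamma> q c' r" for c c'
      using le[OF is_path_append[OF that]] pqr by simp
    then have "graph_dist \<Gamma> p r - path_length c \<le> graph_dist \<Gamma> q r" if "is_path \<Gamma> p c q" for c
      using that by (intro ge pqr) (fastforce simp: algebra_simps)
    then have "graph_dist \<Gamma> p r - graph_dist \<Gamma> q r \<le> graph_dist \<Gamma> p q"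
      by (intro ge pqr) (fastforce simp: algebra_simps)
    then show ?thesis by simp
  qed
qed

text \<open>
  A tangent direction at \<open>p\<close> is a coordinate representation \<open>p = pt \<Gamma> e x\<close> together with a sign \<open>\<sigma>\<close>
  such that \<open>x + \<sigma> * t\<close> stays in the edge for small \<open>t > 0\<close>. In particular a loop contributes two
  directions at its vertex.
\<close>

definition tangents :: "('v, 'e) metric_graph \<Rightarrow> ('v, 'e) point \<Rightarrow> ('e \<times> real \<times> real) set" where
  "tangents \<Gamma> p =
     {(e, x, \<sigma>). e \<in> edges \<Gamma> \<and> x \<in> {0..len \<Gamma> e} \<and> pt \<Gamma> e x = p \<and>
        (\<sigma> = 1 \<and> x < len \<Gamma> e \<or> \<sigma> = -1 \<and> 0 < x)}"

definition valence :: "('v, 'e) metric_graph \<Rightarrow> ('v, 'e) point \<Rightarrow> nat" where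
  "valence \<Gamma> p = card (tangents \<Gamma> p)"


section \<open>Divisors and piecewise linear functions\<close>

type_synonym ('v, 'e) divisor = "('v, 'e) point \<Rightarrow> int"

definition supp :: "('v, 'e) divisor \<Rightarrow> ('v, 'e) point set" where
  "supp D = {p. D p \<noteq> 0}"

definition divisors :: "('v, 'e) metric_graph \<Rightarrow> ('v, 'e) divisor set" where
  "divisors \<Gamma> = {D. finite (supp D) \<and> supp D \<subseteq> points \<Gamma>}"

definition effective :: "('v, 'e) divisor \<Rightarrow> bool" where
  "effective D \<longleftrightarrow> (\<forall>p. 0 \<le> D p)"

definition deg :: "('v, 'e) divisor \<Rightarrow> int" where
  "deg D = (\<Sum>p\<in>supp D. D p)"

text \<open>
  Functions on the metric graph are represented by functions that are \<^const>\<open>undefined\<close> off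
  \<^term>\<open>points \<Gamma>\<close>, so that equality of functions is equality on the metric graph.
\<close>

definition PL :: "('v, 'e) metric_graph \<Rightarrow> (('v, 'e) point \<Rightarrow> real) set" where
  "PL \<Gamma> =
     {\<phi> \<in> extensional (points \<Gamma>).
        continuous_map (graph_topology \<Gamma>) euclideanreal \<phi> \<and>
        (\<forall>e\<in>edges \<Gamma>. \<exists>(n::nat) b. b 0 = 0 \<and> b n = len \<Gamma> e \<and>
           (\<forall>i<n. b i < b (Suc i) \<and>
              (\<exists>m::int. \<forall>x\<in>{b i..b (Suc i)}.
                 \<phi> (pt \<Gamma> e x) = \<phi> (pt \<Gamma> e (b i)) + of_int m * (x - b i))))}"

definition outgoing_slope ::
  "('v, 'e) metric_graph \<Rightarrow> (('v, 'e) point \<Rightarrow> real) \<Rightarrow> 'e \<times> real \<times> real \<Rightarrow> int" where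
  "outgoing_slope \<Gamma> \<phi> = (\<lambda>(e, x, \<sigma>).
     THE m::int. ((\<lambda>t. \<phi> (pt \<Gamma> e (x + \<sigma> * t))) has_real_derivative of_int m) (at_right 0))"

text \<open>The sum of the incoming slopes, i.e. minus the sum of the outgoing slopes.\<close>

definition divisor_of ::
  "('v, 'e) metric_graph \<Rightarrow> (('v, 'e) point \<Rightarrow> real) \<Rightarrow> ('v, 'e) divisor" where
  "divisor_of \<Gamma> \<phi> p = - (\<Sum>\<tau>\<in>tangents \<Gamma> p. outgoing_slope \<Gamma> \<phi> \<tau>)"

definition R :: "('v, 'e) metric_graph \<Rightarrow> ('v, 'e) divisor \<Rightarrow> (('v, 'e) point \<Rightarrow> real) set" where
  "R \<Gamma> D = {\<phi> \<in> PL \<Gamma>. effective (\<lambda>p. D p + divisor_of \<Gamma> \<phi> p)}"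


section \<open>Tropical linear series\<close>

text \<open>
  The zero element \<open>\<infinity>\<close> is left out throughout, so the zero module is represented by the empty set.
\<close>

definition tropical_submodule ::
  "('v, 'e) metric_graph \<Rightarrow> ('v, 'e) divisor \<Rightarrow> (('v, 'e) point \<Rightarrow> real) set \<Rightarrow> bool" where
  "tropical_submodule \<Gamma> D \<Sigma> \<longleftrightarrow>
     \<Sigma> \<subseteq> R \<Gamma> D \<and>
     (\<forall>\<phi>\<in>\<Sigma>. \<forall>\<psi>\<in>\<Sigma>. (\<lambda>p\<in>points \<Gamma>. min (\<phi> p) (\<psi> p)) \<in> \<Sigma>) \<and>
     (\<forall>\<phi>\<in>\<Sigma>. \<forall>a. (\<lambda>p\<in>points \<Gamma>. \<phi> p + a) \<in> \<Sigma>)"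

text \<open>Omitting a generator (\<open>G \<subset> F\<close>) corresponds to giving it the coefficient \<open>\<infinity>\<close>.\<close>

definition finitely_generated ::
  "('v, 'e) metric_graph \<Rightarrow> (('v, 'e) point \<Rightarrow> real) set \<Rightarrow> bool" where
  "finitely_generated \<Gamma> \<Sigma> \<longleftrightarrow>
     (\<exists>F. finite F \<and> F \<subseteq> \<Sigma> \<and>
        \<Sigma> = {\<lambda>p\<in>points \<Gamma>. Min ((\<lambda>\<phi>. \<phi> p + a \<phi>) ` G) | G a. G \<subseteq> F \<and> G \<noteq> {}})"

text \<open>Over \<^typ>\<open>int\<close>, so that the empty series has rank -1.\<close>

definition r_BN ::
  "('v, 'e) metric_graph \<Rightarrow> ('v, 'e) divisor \<Rightarrow> (('v, 'e) point \<Rightarrow> real) set \<Rightarrow> int" where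
  "r_BN \<Gamma> D \<Sigma> =
     (GREATEST r::int. \<forall>D'\<in>divisors \<Gamma>. effective D' \<and> deg D' = r \<longrightarrow>
        (\<exists>\<phi>\<in>\<Sigma>. effective (\<lambda>p. D p - D' p + divisor_of \<Gamma> \<phi> p)))"

definition tropically_dependent ::
  "('v, 'e) metric_graph \<Rightarrow> (('v, 'e) point \<Rightarrow> real) set \<Rightarrow> bool" where
  "tropically_dependent \<Gamma> S \<longleftrightarrow>
     (\<exists>a. \<forall>p\<in>points \<Gamma>. \<exists>\<phi>\<in>S. \<exists>\<psi>\<in>S. \<phi> \<noteq> \<psi> \<and> \<phi> p + a \<phi> = \<psi> p + a \<psi> \<and>
        (\<forall>\<theta>\<in>S. \<phi> p + a \<phi> \<le> \<theta> p + a \<theta>))"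

definition r_ind :: "('v, 'e) metric_graph \<Rightarrow> (('v, 'e) point \<Rightarrow> real) set \<Rightarrow> enat" where
  "r_ind \<Gamma> \<Sigma> = Sup {enat (card S) | S. S \<subseteq> \<Sigma> \<and> finite S \<and> \<not> tropically_dependent \<Gamma> S}"

definition tropical_linear_series ::
  "('v, 'e) metric_graph \<Rightarrow> ('v, 'e) divisor \<Rightarrow> (('v, 'e) point \<Rightarrow> real) set \<Rightarrow> bool" where
  "tropical_linear_series \<Gamma> D \<Sigma> \<longleftrightarrow>
     tropical_submodule \<Gamma> D \<Sigma> \<and> finitely_generated \<Gamma> \<Sigma> \<and>
     (\<exists>n. r_ind \<Gamma> \<Sigma> = enat n \<and> int n = r_BN \<Gamma> D \<Sigma> + 1)"


section \<open>The space of divisors of a series, nondegeneracy\<close>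

definition linear_system ::
  "('v, 'e) metric_graph \<Rightarrow> ('v, 'e) divisor \<Rightarrow> (('v, 'e) point \<Rightarrow> real) set \<Rightarrow> ('v, 'e) divisor set" where
  "linear_system \<Gamma> D \<Sigma> = (\<lambda>\<phi> p. D p + divisor_of \<Gamma> \<phi> p) ` \<Sigma>"

definition quotient_topology :: "'a topology \<Rightarrow> ('a \<Rightarrow> 'b) \<Rightarrow> 'b topology" where
  "quotient_topology X f =
     topology (\<lambda>U. U \<subseteq> f ` topspace X \<and> openin X {x \<in> topspace X. f x \<in> U})"

lemma istopology_quotient_topology:
  "istopology (\<lambda>U. U \<subseteq> f ` topspace X \<and> openin X {x \<in> topspace X. f x \<in> U})"
  unfolding istopology_def
proof (intro conjI allI impI)
  fix S T
  assume "S \<subseteq> f ` topspace X \<and> openin X {x \<in> topspace X. f x \<in> S}"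
    and "T \<subseteq> f ` topspace X \<and> openin X {x \<in> topspace X. f x \<in> T}"
  moreover have "{x \<in> topspace X. f x \<in> S \<inter> T} =
      {x \<in> topspace X. f x \<in> S} \<inter> {x \<in> topspace X. f x \<in> T}"
    by auto
  ultimately show "S \<inter> T \<subseteq> f ` topspace X" "openin X {x \<in> topspace X. f x \<in> S \<inter> T}"
    by auto
next
  fix K
  assume K: "\<forall>U\<in>K. U \<subseteq> f ` topspace X \<and> openin X {x \<in> topspace X. f x \<in> U}"
  then show "\<Union> K \<subseteq> f ` topspace X" by blast
  have "{x \<in> topspace X. f x \<in> \<Union> K} = \<Union> ((\<lambda>U. {x \<in> topspace X. f x \<in> U}) ` K)"
    by auto
  then show "openin X {x \<in> topspace X. f x \<in> \<Union> K}"
    using K by (auto intro!: openin_Union)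
qed

lemma quotient_map_quotient_topology: "quotient_map X (quotient_topology X f) f"
proof -
  have op: "openin (quotient_topology X f) U \<longleftrightarrow>
      U \<subseteq> f ` topspace X \<and> openin X {x \<in> topspace X. f x \<in> U}" for U
    unfolding quotient_topology_def topology_inverse'[OF istopology_quotient_topology] ..
  have "{x \<in> topspace X. f x \<in> f ` topspace X} = topspace X"
    by auto
  then have "openin (quotient_topology X f) (f ` topspace X)"
    by (simp add: op)
  then have "topspace (quotient_topology X f) = f ` topspace X"
    using op openin_subset by (metis openin_topspace subset_antisym)
  then show ?thesis
    by (simp add: quotient_map_def op)
qed

text \<open>
  The orbit of \<open>(x 0, \<dots>, x (d - 1))\<close> under the symmetric group is identified with the effective
  divisor \<open>x 0 + \<dots> + x (d - 1)\<close> of degree \<open>d\<close>.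
\<close>

definition sum_divisor :: "nat \<Rightarrow> (nat \<Rightarrow> ('v, 'e) point) \<Rightarrow> ('v, 'e) divisor" where
  "sum_divisor d x = (\<lambda>p. int (card {i. i < d \<and> x i = p}))"

definition Sym_topology :: "('v, 'e) metric_graph \<Rightarrow> nat \<Rightarrow> ('v, 'e) divisor topology" where
  "Sym_topology \<Gamma> d =
     quotient_topology (product_topology (\<lambda>_. graph_topology \<Gamma>) {..<d}) (sum_divisor d)"

definition linear_system_topology ::
  "('v, 'e) metric_graph \<Rightarrow> ('v, 'e) divisor \<Rightarrow> (('v, 'e) point \<Rightarrow> real) set \<Rightarrow> ('v, 'e) divisor topology"
where
  "linear_system_topology \<Gamma> D \<Sigma> =
     subtopology (Sym_topology \<Gamma> (nat (deg D))) (linear_system \<Gamma> D \<Sigma>)"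

definition local_maximum :: "'a topology \<Rightarrow> ('a \<Rightarrow> 'b::ord) \<Rightarrow> 'a \<Rightarrow> bool" where
  "local_maximum X f x \<longleftrightarrow> (\<exists>U. openin X U \<and> x \<in> U \<and> (\<forall>y\<in>U. f y \<le> f x))"

definition local_minimum :: "'a topology \<Rightarrow> ('a \<Rightarrow> 'b::ord) \<Rightarrow> 'a \<Rightarrow> bool" where
  "local_minimum X f x \<longleftrightarrow> (\<exists>U. openin X U \<and> x \<in> U \<and> (\<forall>y\<in>U. f x \<le> f y))"

definition valence1_degree :: "('v, 'e) metric_graph \<Rightarrow> ('v, 'e) divisor \<Rightarrow> int" where
  "valence1_degree \<Gamma> E = (\<Sum>p\<in>{p \<in> points \<Gamma>. valence \<Gamma> p = 1}. E p)"

definition nondegenerate ::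
  "('v, 'e) metric_graph \<Rightarrow> ('v, 'e) divisor \<Rightarrow> (('v, 'e) point \<Rightarrow> real) set \<Rightarrow> ('v, 'e) divisor \<Rightarrow> bool"
where
  "nondegenerate \<Gamma> D \<Sigma> E \<longleftrightarrow>
     E \<in> linear_system \<Gamma> D \<Sigma> \<and>
     local_maximum (linear_system_topology \<Gamma> D \<Sigma>) (\<lambda>E. card (supp E)) E \<and>
     local_minimum (linear_system_topology \<Gamma> D \<Sigma>) (valence1_degree \<Gamma>) E"

definition argmin :: "('v, 'e) metric_graph \<Rightarrow> (('v, 'e) point \<Rightarrow> real) \<Rightarrow> ('v, 'e) point set" where
  "argmin \<Gamma> \<phi> = {p \<in> points \<Gamma>. \<forall>q\<in>points \<Gamma>. \<phi> p \<le> \<phi> q}"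

definition isolated_points :: "'a topology \<Rightarrow> 'a set \<Rightarrow> 'a set" where
  "isolated_points X S = {x \<in> S. \<exists>U. openin X U \<and> U \<inter> S = {x}}"

end

theory Submission
  imports Defs
begin

text \<open>
  Since \<open>D \<in> |\<Sigma>|\<close>, the module \<open>\<Sigma>\<close> contains a function with trivial divisor, hence all constants, and
  so it contains \<open>\<psi>\<^sub>\<epsilon> = min(\<phi>, min \<phi> + \<epsilon>)\<close> for \<open>\<phi> \<in> \<Sigma>\<close>. For small \<open>\<epsilon> > 0\<close> the divisor
  \<open>D + div(\<psi>\<^sub>\<epsilon>)\<close> arises from \<open>D\<close> by moving, along each tangent direction in which \<open>\<phi>\<close> leaves its
  minimum with slope \<open>m > 0\<close>, exactly \<open>m\<close> chips from the base point to distance \<open>\<epsilon>/m\<close>; in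
  particular it tends to \<open>D\<close>. Every base point sends out at least one chip pile, so the support does
  not shrink. At an isolated minimum all tangent directions are of this kind: if there are at least
  two of them, the support grows, and if there is only one, the valence 1 degree drops. Both
  contradict nondegeneracy.
\<close>

section \<open>Points and tangent directions\<close>

text \<open>A function with trivial divisor is constant because no outgoing slope at a minimum is
  negative: a zero sum kills them all, and the minimum value spreads over the graph. The support
  count must survive the worst case in which every base point gives up all its chips, so the landing
  points have to be pairwise distinct and off the support of \<open>D\<close>. They are distinct
  because \<open>\<phi>\<close> decreases in exactly one direction at a landing point, and they
  avoid the support because only finitely many levels \<open>\<epsilon>\<close> are excluded. The
  minimum set may be infinite, but effectivity of \<open>D + div(\<phi>)\<close> confines the bases
  of rising directions to the finite set \<open>supp D\<close>. Only finitely many smallness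
  conditions on \<open>\<epsilon>\<close> arise, and they are collected by the filter
  \<open>at_right 0\<close>. Convergence in a quotient of \<open>\<Gamma>^d\<close> is obtained by
  labelling the chips of \<open>D\<close> beforehand, so that every label follows its own path;
  effectivity again guarantees enough chips at each base point. Landing points are inner points of
  edges, hence have valence 2, so the chips that leave a point of valence 1 do not arrive at another
  one.\<close>

lemma finite_edges: "is_metric_graph \<Gamma> \<Longrightarrow> finite (edges \<Gamma>)"
  by (simp add: is_metric_graph_def fin_digraph.finite_arcs)

lemma len_pos: "is_metric_graph \<Gamma> \<Longrightarrow> e \<in> edges \<Gamma> \<Longrightarrow> 0 < len \<Gamma> e"
  by (simp add: is_metric_graph_def)

lemma pt_in_points:
  assumes "is_metric_graph \<Gamma>" "e \<in> edges \<Gamma>" "x \<in> {0..len \<Gamma> e}"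
  shows "pt \<Gamma> e x \<in> points \<Gamma>"
proof -
  interpret fin_digraph "model \<Gamma>" using assms by (simp add: is_metric_graph_def)
  show ?thesis using assms by (auto simp: pt_def points_def)
qed

lemma pt_Inner: "0 < x \<Longrightarrow> x < len \<Gamma> e \<Longrightarrow> pt \<Gamma> e x = Inner e x"
  by (simp add: pt_def)

lemma pt_eq_Inner_iff: "pt \<Gamma> e x = Inner d y \<longleftrightarrow> e = d \<and> x = y \<and> x \<noteq> 0 \<and> x \<noteq> len \<Gamma> e"
  by (auto simp: pt_def)

lemma topspace_graph_topology:
  "is_metric_graph \<Gamma> \<Longrightarrow> topspace (graph_topology \<Gamma>) = points \<Gamma>"
  unfolding graph_topology_def
  by (rule Metric_space.topspace_mtopology[OF Metric_space_graph])

lemma graph_dist_pt_le: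
  assumes "is_metric_graph \<Gamma>" "e \<in> edges \<Gamma>" "x \<in> {0..len \<Gamma> e}" "y \<in> {0..len \<Gamma> e}"
  shows "graph_dist \<Gamma> (pt \<Gamma> e x) (pt \<Gamma> e y) \<le> \<bar>x - y\<bar>"
proof -
  have "is_path \<Gamma> (pt \<Gamma> e x) [(e, x, y)] (pt \<Gamma> e y)" "path_length [(e, x, y)] = \<bar>x - y\<bar>"
    using assms by auto
  then have "\<bar>x - y\<bar> \<in> {path_length c | c. is_path \<Gamma> (pt \<Gamma> e x) c (pt \<Gamma> e y)}"
    by (metis (mono_tags, lifting) mem_Collect_eq)
  moreover have "bdd_below {path_length c | c. is_path \<Gamma> (pt \<Gamma> e x) c (pt \<Gamma> e y)}"
    using path_length_nonneg by (auto intro!: bdd_belowI[of _ 0])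
  ultimately show ?thesis
    using pt_in_points assms by (auto simp: graph_dist_def intro: cInf_lower)
qed

lemma continuous_map_pt:
  assumes \<Gamma>: "is_metric_graph \<Gamma>" and e: "e \<in> edges \<Gamma>"
  shows "continuous_map (top_of_set {0..len \<Gamma> e}) (graph_topology \<Gamma>) (pt \<Gamma> e)"
proof -
  interpret Metric_space "points \<Gamma>" "graph_dist \<Gamma>" by (rule Metric_space_graph[OF \<Gamma>])
  show ?thesis
    unfolding graph_topology_def continuous_map_to_metric
  proof (intro ballI allI impI)
    fix x and \<epsilon> :: real
    assume x: "x \<in> topspace (top_of_set {0..len \<Gamma> e})" and "0 < \<epsilon>"
    have "openin (top_of_set {0..len \<Gamma> e}) ({0..len \<Gamma> e} \<inter> ball x \<epsilon>)"
      by (simp add: openin_open_Int)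
    moreover have "pt \<Gamma> e y \<in> mball (pt \<Gamma> e x) \<epsilon>" if "y \<in> {0..len \<Gamma> e} \<inter> ball x \<epsilon>" for y
      using that x graph_dist_pt_le[OF \<Gamma> e, of x y] pt_in_points[OF \<Gamma> e]
      by (auto simp: dist_real_def)
    ultimately show "\<exists>U. openin (top_of_set {0..len \<Gamma> e}) U \<and> x \<in> U \<and>
        (\<forall>y\<in>U. pt \<Gamma> e y \<in> mball (pt \<Gamma> e x) \<epsilon>)"
      using x \<open>0 < \<epsilon>\<close> by (intro exI[of _ "{0..len \<Gamma> e} \<inter> ball x \<epsilon>"]) auto
  qed
qed

lemma limitin_pt:
  assumes \<Gamma>: "is_metric_graph \<Gamma>" and e: "e \<in> edges \<Gamma>"
    and "\<forall>\<^sub>F t in F. f t \<in> {0..len \<Gamma> e}" "x \<in> {0..len \<Gamma> e}" "(f \<longlongrightarrow> x) F"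
  shows "limitin (graph_topology \<Gamma>) (\<lambda>t. pt \<Gamma> e (f t)) (pt \<Gamma> e x) F"
proof -
  have "limitin (top_of_set {0..len \<Gamma> e}) f x F"
    using assms by (simp add: limitin_subtopology)
  from continuous_map_limit[OF continuous_map_pt[OF \<Gamma> e] this] show ?thesis
    by (simp add: o_def)
qed

lemma tangents_Inner:
  assumes "e \<in> edges \<Gamma>" "0 < x" "x < len \<Gamma> e"
  shows "tangents \<Gamma> (Inner e x) = {(e, x, 1), (e, x, -1)}"
  using assms by (auto simp: tangents_def pt_eq_Inner_iff)

lemma finite_tangents:
  assumes "is_metric_graph \<Gamma>"
  shows "finite (tangents \<Gamma> p)"
proof -
  \<comment> \<open>On any edge, a coordinate of \<open>p\<close> is an end of the edge or the
    coordinate stored in an inner point. The default 0 for a vertex adds nothing, being already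
    listed.\<close>
  have "tangents \<Gamma> p \<subseteq>
      (\<Union>e\<in>edges \<Gamma>. {e} \<times> {0, len \<Gamma> e, case p of Inner _ y \<Rightarrow> y | _ \<Rightarrow> 0} \<times> {1, -1})"
    by (fastforce simp: tangents_def pt_def split: if_splits point.splits)
  then show ?thesis
    by (rule finite_subset) (use assms finite_edges in auto)
qed

text \<open>Connectedness gives a path from \<open>p\<close> to some other point, and its first
  segment places \<open>p\<close> on a closed edge. This is what rules out vertices without incident
  edges.\<close>

lemma tangents_nonempty:
  assumes \<Gamma>: "is_metric_graph \<Gamma>" and p: "p \<in> points \<Gamma>"
  shows "tangents \<Gamma> p \<noteq> {}"
proof -
  obtain d where d: "d \<in> edges \<Gamma>" using \<Gamma> by (auto simp: is_metric_graph_def)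
  have L: "0 < len \<Gamma> d" using len_pos[OF \<Gamma> d] .
  \<comment> \<open>Two different interior points, at one half and one third of the edge, are kept
    ready so that one of them differs from \<open>p\<close>.\<close>
  have *: "Inner d (len \<Gamma> d / i) \<in> points \<Gamma>" if "1 < i" for i
    using d L that divide_strict_left_mono[of 1 i "len \<Gamma> d"] by (auto simp: points_def)
  obtain q where q: "q \<in> points \<Gamma>" "p \<noteq> q"
  proof (cases "p = Inner d (len \<Gamma> d / 2)")
    case True
    then show ?thesis using *[of 3] L by (intro that[of "Inner d (len \<Gamma> d / 3)"]) auto
  next
    case False
    then show ?thesis using *[of 2] by (intro that[of "Inner d (len \<Gamma> d / 2)"]) auto
  qed
  obtain c where "is_path \<Gamma> p c q" using path_connected_points[OF \<Gamma> p q(1)] by blast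
  with q(2) obtain e x where ex: "e \<in> edges \<Gamma>" "x \<in> {0..len \<Gamma> e}" "p = pt \<Gamma> e x"
    by (cases "(\<Gamma>, p, c, q)" rule: is_path.cases) auto
  show ?thesis
  proof (cases "x < len \<Gamma> e")
    case True
    with ex have "(e, x, 1) \<in> tangents \<Gamma> p" by (auto simp: tangents_def)
    then show ?thesis by blast
  next
    case False
    with ex len_pos[OF \<Gamma> ex(1)] have "(e, x, -1) \<in> tangents \<Gamma> p" by (auto simp: tangents_def)
    then show ?thesis by blast
  qed
qed

lemma point_on_edge:
  assumes "is_metric_graph \<Gamma>" "p \<in> points \<Gamma>"
  obtains e x where "e \<in> edges \<Gamma>" "x \<in> {0..len \<Gamma> e}" "p = pt \<Gamma> e x"
  using tangents_nonempty[OF assms] that by (auto simp: tangents_def)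

text \<open>Inner points have two tangent directions, so only vertices can have valence 1. Hence
  \<open>valence1_degree\<close> is a sum over a finite set and strict comparison of such sums makes
  sense.\<close>

lemma finite_valence_1:
  assumes "is_metric_graph \<Gamma>"
  shows "finite {p \<in> points \<Gamma>. valence \<Gamma> p = 1}"
proof -
  interpret fin_digraph "model \<Gamma>" using assms by (simp add: is_metric_graph_def)
  have "{p \<in> points \<Gamma>. valence \<Gamma> p = 1} \<subseteq> Vertex ` verts (model \<Gamma>)"
    by (auto simp: points_def valence_def tangents_Inner)
  then show ?thesis by (rule finite_subset) auto
qed


section \<open>Piecewise linear functions\<close>

text \<open>Both half-open versions are needed: at a breakpoint, a tangent direction enters the
  piece on its own side.\<close>

lemma strict_partition_piece:
  fixes b :: "nat \<Rightarrow> real"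
  assumes "\<And>i. i < n \<Longrightarrow> b i < b (Suc i)"
  shows "x \<in> {b 0..<b n} \<Longrightarrow> \<exists>i<n. b i \<le> x \<and> x < b (Suc i)"
    and "x \<in> {b 0<..b n} \<Longrightarrow> \<exists>i<n. b i < x \<and> x \<le> b (Suc i)"
  using assms
proof (induction n)
  case (Suc n)
  { case 1 then show ?case using Suc.IH(1) by (cases "x < b n") (auto intro: less_SucI) }
  { case 2 then show ?case using Suc.IH(2) by (cases "x \<le> b n") (auto intro: less_SucI) }
qed auto

text \<open>The linear formula is made symmetric in two arbitrary points of a piece, so that either
  end or an interior point can serve as origin.\<close>

lemma PL_partition:
  assumes "\<phi> \<in> PL \<Gamma>" "e \<in> edges \<Gamma>"
  obtains n and b :: "nat \<Rightarrow> real" where "b 0 = 0" "b n = len \<Gamma> e"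
    "\<And>i. i < n \<Longrightarrow> b i < b (Suc i)" "\<And>i. i \<le> n \<Longrightarrow> b i \<in> {0..len \<Gamma> e}"
    "\<And>i. i < n \<Longrightarrow> \<exists>m::int. \<forall>x\<in>{b i..b (Suc i)}. \<forall>y\<in>{b i..b (Suc i)}.
       \<phi> (pt \<Gamma> e y) = \<phi> (pt \<Gamma> e x) + of_int m * (y - x)"
proof -
  from assms obtain n and b :: "nat \<Rightarrow> real" where b: "b 0 = 0" "b n = len \<Gamma> e"
    "\<And>i. i < n \<Longrightarrow> b i < b (Suc i)"
    and m: "\<And>i. i < n \<Longrightarrow> \<exists>m::int. \<forall>x\<in>{b i..b (Suc i)}.
                 \<phi> (pt \<Gamma> e x) = \<phi> (pt \<Gamma> e (b i)) + of_int m * (x - b i)"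
    by (auto simp: PL_def)
  have mono: "b i \<le> b j" if "i \<le> j" "j \<le> n" for i j
    using that
  proof (induction j rule: dec_induct)
    case (step k)
    then show ?case using b(3)[of k] by linarith
  qed simp
  have "b i \<in> {0..len \<Gamma> e}" if "i \<le> n" for i
    using mono[of 0 i] mono[of i n] that b by auto
  moreover have "\<exists>m::int. \<forall>x\<in>{b i..b (Suc i)}. \<forall>y\<in>{b i..b (Suc i)}.
       \<phi> (pt \<Gamma> e y) = \<phi> (pt \<Gamma> e x) + of_int m * (y - x)" if i: "i < n" for i
  proof -
    obtain k :: int where k: "\<And>x. x \<in> {b i..b (Suc i)} \<Longrightarrow>
                 \<phi> (pt \<Gamma> e x) = \<phi> (pt \<Gamma> e (b i)) + of_int k * (x - b i)"
      using m[OF i] by blast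
    show ?thesis
    proof (intro exI[of _ k] ballI)
      fix x y assume "x \<in> {b i..b (Suc i)}" "y \<in> {b i..b (Suc i)}"
      from k[OF this(1)] k[OF this(2)]
      show "\<phi> (pt \<Gamma> e y) = \<phi> (pt \<Gamma> e x) + of_int k * (y - x)"
        by (simp add: algebra_simps)
    qed
  qed
  ultimately show ?thesis using that[of b n] b by blast
qed

text \<open>The difference quotients at 0 are eventually constant, and uniqueness of limits makes
  the definite description in \<open>outgoing_slope\<close> well defined.\<close>

lemma outgoing_slope_eqI:
  assumes "0 < \<delta>" and "\<And>t. t \<in> {0..\<delta>} \<Longrightarrow> \<psi> (pt \<Gamma> e (x + \<sigma> * t)) = c + of_int m * t"
  shows "outgoing_slope \<Gamma> \<psi> (e, x, \<sigma>) = m"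
proof -
  let ?f = "\<lambda>t. \<psi> (pt \<Gamma> e (x + \<sigma> * t))"
  have "\<forall>\<^sub>F t in at_right 0. t \<in> {0<..<\<delta>}"
    using eventually_at_right_real[OF \<open>0 < \<delta>\<close>] .
  then have ev: "\<forall>\<^sub>F t in at_right 0. (?f t - ?f 0) / (t - 0) = of_int m"
    by eventually_elim (use assms(2)[of 0] assms in auto)
  then have "((\<lambda>t. (?f t - ?f 0) / (t - 0)) \<longlongrightarrow> of_int m) (at_right 0)"
    by (rule tendsto_eventually)
  then have "(?f has_real_derivative of_int k) (at_right 0) \<longleftrightarrow> k = m" for k :: int
    unfolding has_field_derivative_iff using tendsto_unique[OF trivial_limit_at_right_real] by fastforce
  then show ?thesis
    unfolding outgoing_slope_def prod.case by simp
qed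

text \<open>The linear piece into which the direction points provides \<open>\<delta>\<close>;
  walking left along the edge changes the sign of its slope. All later slope computations start from
  this normal form.\<close>

lemma PL_tangent_linear:
  assumes \<phi>: "\<phi> \<in> PL \<Gamma>" and \<tau>: "(e, x, \<sigma>) \<in> tangents \<Gamma> p"
  obtains \<delta> where "0 < \<delta>" "\<And>t. t \<in> {0..\<delta>} \<Longrightarrow> x + \<sigma> * t \<in> {0..len \<Gamma> e} \<and>
    \<phi> (pt \<Gamma> e (x + \<sigma> * t)) = \<phi> p + of_int (outgoing_slope \<Gamma> \<phi> (e, x, \<sigma>)) * t"
proof -
  have e: "e \<in> edges \<Gamma>" and p: "pt \<Gamma> e x = p" using \<tau> by (auto simp: tangents_def)
  obtain n and b :: "nat \<Rightarrow> real" where b: "b 0 = 0" "b n = len \<Gamma> e"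
    "\<And>i. i < n \<Longrightarrow> b i < b (Suc i)" "\<And>i. i \<le> n \<Longrightarrow> b i \<in> {0..len \<Gamma> e}"
    and lin: "\<And>i. i < n \<Longrightarrow> \<exists>m::int. \<forall>x\<in>{b i..b (Suc i)}. \<forall>y\<in>{b i..b (Suc i)}.
       \<phi> (pt \<Gamma> e y) = \<phi> (pt \<Gamma> e x) + of_int m * (y - x)"
    using PL_partition[OF \<phi> e] by metis
  have "\<exists>\<delta> m. 0 < \<delta> \<and> (\<forall>t\<in>{0..\<delta>}. x + \<sigma> * t \<in> {0..len \<Gamma> e} \<and>
    \<phi> (pt \<Gamma> e (x + \<sigma> * t)) = \<phi> p + of_int (m::int) * t)"
  proof (cases "\<sigma> = 1")
    case True
    with \<tau> b have "x \<in> {b 0..<b n}" by (auto simp: tangents_def)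
    then obtain i where i: "i < n" "b i \<le> x" "x < b (Suc i)"
      using strict_partition_piece(1) b(3) by blast
    obtain m :: int where m: "\<forall>x\<in>{b i..b (Suc i)}. \<forall>y\<in>{b i..b (Suc i)}.
       \<phi> (pt \<Gamma> e y) = \<phi> (pt \<Gamma> e x) + of_int m * (y - x)" using lin i by blast
    show ?thesis
      using m[rule_format, of x] i True b(4)[of "Suc i"] b(4)[of i] p
      by (intro exI[of _ "b (Suc i) - x"] exI[of _ m]) auto
  next
    case False
    with \<tau> b have "x \<in> {b 0<..b n}" and s: "\<sigma> = -1" by (auto simp: tangents_def)
    then obtain i where i: "i < n" "b i < x" "x \<le> b (Suc i)"
      using strict_partition_piece(2) b(3) by blast
    obtain m :: int where m: "\<forall>x\<in>{b i..b (Suc i)}. \<forall>y\<in>{b i..b (Suc i)}.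
       \<phi> (pt \<Gamma> e y) = \<phi> (pt \<Gamma> e x) + of_int m * (y - x)" using lin i by blast
    show ?thesis
      using m[rule_format, of x] i s b(4)[of "Suc i"] b(4)[of i] p
      by (intro exI[of _ "x - b i"] exI[of _ "-m"]) auto
  qed
  then obtain \<delta> m where \<delta>: "0 < \<delta>" "\<And>t. t \<in> {0..\<delta>} \<Longrightarrow> x + \<sigma> * t \<in> {0..len \<Gamma> e} \<and>
    \<phi> (pt \<Gamma> e (x + \<sigma> * t)) = \<phi> p + of_int (m::int) * t" by blast
  moreover from this have "outgoing_slope \<Gamma> \<phi> (e, x, \<sigma>) = m"
    by (intro outgoing_slope_eqI[of \<delta>]) auto
  ultimately show ?thesis using that by blast
qed

lemma PL_continuous_on_edge:
  assumes "is_metric_graph \<Gamma>" "\<phi> \<in> PL \<Gamma>" "e \<in> edges \<Gamma>"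
  shows "continuous_on {0..len \<Gamma> e} (\<lambda>x. \<phi> (pt \<Gamma> e x))"
  using continuous_map_compose[OF continuous_map_pt[OF assms(1,3)], of euclideanreal \<phi>] assms(2)
  by (simp add: PL_def o_def)

section \<open>Minima of piecewise linear functions, and functions with trivial divisor\<close>

lemma PL_argmin_nonempty:
  assumes \<Gamma>: "is_metric_graph \<Gamma>" and \<phi>: "\<phi> \<in> PL \<Gamma>"
  shows "argmin \<Gamma> \<phi> \<noteq> {}"
proof -
  \<comment> \<open>The extreme value theorem is applied edge by edge; the least of the finitely
    many edge minima is the global minimum.\<close>
  have "\<exists>x\<in>{0..len \<Gamma> e}. \<forall>y\<in>{0..len \<Gamma> e}. \<phi> (pt \<Gamma> e x) \<le> \<phi> (pt \<Gamma> e y)"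
    if e: "e \<in> edges \<Gamma>" for e
  proof (rule continuous_attains_inf[OF compact_Icc _ PL_continuous_on_edge[OF \<Gamma> \<phi> e]])
    show "{0..len \<Gamma> e} \<noteq> {}" using len_pos[OF \<Gamma> e] by simp
  qed
  then have "\<forall>e\<in>edges \<Gamma>. \<exists>x. x \<in> {0..len \<Gamma> e} \<and>
      (\<forall>y\<in>{0..len \<Gamma> e}. \<phi> (pt \<Gamma> e x) \<le> \<phi> (pt \<Gamma> e y))"
    unfolding Bex_def by blast
  then obtain X where X: "\<forall>e\<in>edges \<Gamma>. X e \<in> {0..len \<Gamma> e} \<and>
      (\<forall>y\<in>{0..len \<Gamma> e}. \<phi> (pt \<Gamma> e (X e)) \<le> \<phi> (pt \<Gamma> e y))"
    unfolding bchoice_iff ..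
  let ?M = "(\<lambda>e. \<phi> (pt \<Gamma> e (X e))) ` edges \<Gamma>"
  have fin: "finite ?M" using finite_edges[OF \<Gamma>] by blast
  have "?M \<noteq> {}" using \<Gamma> by (simp add: is_metric_graph_def)
  from Min_in[OF fin this] obtain d where d: "d \<in> edges \<Gamma>" "Min ?M = \<phi> (pt \<Gamma> d (X d))"
    by blast
  have d_le: "\<phi> (pt \<Gamma> d (X d)) \<le> \<phi> (pt \<Gamma> e (X e))" if "e \<in> edges \<Gamma>" for e
    unfolding d(2)[symmetric] using fin that by (intro Min_le) auto
  have "pt \<Gamma> d (X d) \<in> argmin \<Gamma> \<phi>"
    unfolding argmin_def
  proof (intro CollectI conjI ballI)
    show "pt \<Gamma> d (X d) \<in> points \<Gamma>" by (rule pt_in_points[OF \<Gamma> d(1)]) (use X d(1) in blast)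
    fix q assume "q \<in> points \<Gamma>"
    then obtain e x where "e \<in> edges \<Gamma>" "x \<in> {0..len \<Gamma> e}" "q = pt \<Gamma> e x"
      by (rule point_on_edge[OF \<Gamma>])
    then have "\<phi> (pt \<Gamma> d (X d)) \<le> \<phi> (pt \<Gamma> e (X e))" "\<phi> (pt \<Gamma> e (X e)) \<le> \<phi> q"
      using d_le X by blast+
    then show "\<phi> (pt \<Gamma> d (X d)) \<le> \<phi> q" by (rule order_trans)
  qed
  then show ?thesis by blast
qed

lemma argmin_slope_nonneg:
  assumes "is_metric_graph \<Gamma>" "\<phi> \<in> PL \<Gamma>" "p \<in> argmin \<Gamma> \<phi>" "\<tau> \<in> tangents \<Gamma> p"
  shows "0 \<le> outgoing_slope \<Gamma> \<phi> \<tau>"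
proof -
  obtain e x \<sigma> where \<tau>: "\<tau> = (e, x, \<sigma>)" by (cases \<tau>)
  obtain \<delta> where \<delta>: "0 < \<delta>" "\<And>t. t \<in> {0..\<delta>} \<Longrightarrow> x + \<sigma> * t \<in> {0..len \<Gamma> e} \<and>
    \<phi> (pt \<Gamma> e (x + \<sigma> * t)) = \<phi> p + of_int (outgoing_slope \<Gamma> \<phi> (e, x, \<sigma>)) * t"
    using PL_tangent_linear assms \<tau> by metis
  have "pt \<Gamma> e (x + \<sigma> * \<delta>) \<in> points \<Gamma>"
    using \<delta> assms \<tau> by (intro pt_in_points) (auto simp: tangents_def)
  then have "\<phi> p \<le> \<phi> (pt \<Gamma> e (x + \<sigma> * \<delta>))" using assms by (simp add: argmin_def)
  with \<delta>(2)[of \<delta>] \<delta>(1) have "0 \<le> of_int (outgoing_slope \<Gamma> \<phi> \<tau>) * \<delta>" using \<tau> by simp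
  with \<delta>(1) show ?thesis by (simp add: zero_le_mult_iff)
qed

text \<open>At a minimum the outgoing slopes are nonnegative with sum zero, so all of them vanish.
  The minimum level is therefore open, and by continuity closed, in each edge that it meets;
  connectedness of intervals fills the edge, and paths carry the value from edge to edge.\<close>

lemma PL_constant_if_divisor_0:
  assumes \<Gamma>: "is_metric_graph \<Gamma>" and \<phi>: "\<phi> \<in> PL \<Gamma>" and div: "\<And>p. divisor_of \<Gamma> \<phi> p = 0"
  obtains c where "\<And>p. p \<in> points \<Gamma> \<Longrightarrow> \<phi> p = c"
proof -
  obtain p0 where p0: "p0 \<in> argmin \<Gamma> \<phi>" using PL_argmin_nonempty[OF \<Gamma> \<phi>] by blast
  define \<mu> where "\<mu> = \<phi> p0"
  have slope0: "outgoing_slope \<Gamma> \<phi> \<tau> = 0"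
    if "p \<in> points \<Gamma>" "\<phi> p = \<mu>" "\<tau> \<in> tangents \<Gamma> p" for p \<tau>
  proof -
    have "p \<in> argmin \<Gamma> \<phi>" using that p0 by (simp add: argmin_def \<mu>_def)
    then have "\<forall>\<tau>\<in>tangents \<Gamma> p. 0 \<le> outgoing_slope \<Gamma> \<phi> \<tau>"
      using argmin_slope_nonneg[OF \<Gamma> \<phi>] by blast
    moreover have "(\<Sum>\<tau>\<in>tangents \<Gamma> p. outgoing_slope \<Gamma> \<phi> \<tau>) = 0"
      using div[of p] by (simp add: divisor_of_def)
    ultimately show ?thesis
      using sum_nonneg_eq_0_iff[OF finite_tangents[OF \<Gamma>]] that(3) by blast
  qed
  have edge: "\<phi> (pt \<Gamma> e y) = \<mu>"
    if e: "e \<in> edges \<Gamma>" and x: "x \<in> {0..len \<Gamma> e}" "\<phi> (pt \<Gamma> e x) = \<mu>" and y: "y \<in> {0..len \<Gamma> e}" for e x y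
  proof -
    let ?I = "{0..len \<Gamma> e}"
    define S where "S = {x \<in> ?I. \<phi> (pt \<Gamma> e x) = \<mu>}"
    have dir: "\<exists>\<delta>>0. \<forall>t\<in>{0..\<delta>}. x + \<sigma> * t \<in> ?I \<longrightarrow> x + \<sigma> * t \<in> S"
      if "x \<in> S" "\<sigma> = 1 \<or> \<sigma> = -1" for x \<sigma>
    proof (cases "(e, x, \<sigma>) \<in> tangents \<Gamma> (pt \<Gamma> e x)")
      case True
      have "outgoing_slope \<Gamma> \<phi> (e, x, \<sigma>) = 0"
        using that pt_in_points[OF \<Gamma> e, of x] by (intro slope0[OF _ _ True]) (auto simp: S_def)
      then show ?thesis
      proof -
        obtain \<delta> where "0 < \<delta>" "\<And>t. t \<in> {0..\<delta>} \<Longrightarrow> x + \<sigma> * t \<in> ?I \<and>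
            \<phi> (pt \<Gamma> e (x + \<sigma> * t)) = \<phi> (pt \<Gamma> e x) + of_int (outgoing_slope \<Gamma> \<phi> (e, x, \<sigma>)) * t"
          using PL_tangent_linear[OF \<phi> True] by metis
        with \<open>outgoing_slope \<Gamma> \<phi> (e, x, \<sigma>) = 0\<close> that(1) show ?thesis
          by (intro exI[of _ \<delta>]) (simp add: S_def)
      qed
    next
      case False
      \<comment> \<open>Without a tangent direction, \<open>x\<close> is the end of the edge towards
        which \<open>\<sigma>\<close> points, and only \<open>t = 0\<close> keeps the coordinate
        inside the edge.\<close>
      with that e have "(\<sigma> = 1 \<and> x = len \<Gamma> e) \<or> (\<sigma> = -1 \<and> x = 0)"
        by (auto simp: tangents_def S_def)
      then have "t = 0" if "t \<in> {0..1}" "x + \<sigma> * t \<in> ?I" for t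
        using that by auto
      then have "\<forall>t\<in>{0..1}. x + \<sigma> * t \<in> ?I \<longrightarrow> x + \<sigma> * t \<in> S"
        using that(1) by fastforce
      then show ?thesis by (intro exI[of _ 1]) simp
    qed
    have "openin (top_of_set ?I) S"
      unfolding openin_euclidean_subtopology_iff
    proof (intro conjI ballI)
      show "S \<subseteq> ?I" by (auto simp: S_def)
      fix x assume x: "x \<in> S"
      obtain d1 where d1: "d1 > 0" "\<And>t. t \<in> {0..d1} \<Longrightarrow> x + t \<in> ?I \<Longrightarrow> x + t \<in> S"
        using dir[OF x, of 1] by auto
      obtain d2 where d2: "d2 > 0" "\<And>t. t \<in> {0..d2} \<Longrightarrow> x - t \<in> ?I \<Longrightarrow> x - t \<in> S"
        using dir[OF x, of "-1"] by auto
      show "\<exists>d>0. \<forall>x'\<in>?I. dist x' x < d \<longrightarrow> x' \<in> S"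
      proof (intro exI[of _ "min d1 d2"] conjI ballI impI)
        fix x' assume "x' \<in> ?I" "dist x' x < min d1 d2"
        then show "x' \<in> S"
          using d1(2)[of "x' - x"] d2(2)[of "x - x'"] by (cases "x \<le> x'") (auto simp: dist_real_def)
      qed (use d1 d2 in auto)
    qed
    moreover have "closedin (top_of_set ?I) S"
      unfolding S_def by (intro continuous_closedin_preimage_constant PL_continuous_on_edge \<Gamma> \<phi> e)
    moreover have "Topological_Spaces.connected ?I" by (rule connected_Icc)
    ultimately have "S = {} \<or> S = ?I" unfolding connected_clopen by blast
    moreover have "x \<in> S" using x by (simp add: S_def)
    ultimately have "y \<in> S" using y by blast
    then show ?thesis by (simp add: S_def)
  qed
  have path: "\<phi> q = \<mu>" if "is_path \<Gamma> p c q" "\<phi> p = \<mu>" for p c q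
    using that
  proof (induction c arbitrary: p)
    case (Cons s c)
    obtain e x y where s: "s = (e, x, y)" by (cases s)
    with Cons.prems have e: "e \<in> edges \<Gamma>" "x \<in> {0..len \<Gamma> e}" "y \<in> {0..len \<Gamma> e}"
      "p = pt \<Gamma> e x" "is_path \<Gamma> (pt \<Gamma> e y) c q" by auto
    with Cons.prems(2) have "\<phi> (pt \<Gamma> e y) = \<mu>" using edge[OF e(1,2) _ e(3)] by blast
    with e(5) show ?case by (rule Cons.IH)
  qed auto
  have p0': "p0 \<in> points \<Gamma>" using p0 by (simp add: argmin_def)
  show ?thesis
  proof (rule that)
    fix p assume "p \<in> points \<Gamma>"
    then obtain c where "is_path \<Gamma> p0 c p" using path_connected_points[OF \<Gamma> p0'] by blast
    then show "\<phi> p = \<mu>" by (rule path) (simp add: \<mu>_def)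
  qed
qed

section \<open>Slopes of a function cut off at a level\<close>

lemma outgoing_slope_truncation:
  assumes \<Gamma>: "is_metric_graph \<Gamma>" and \<phi>: "\<phi> \<in> PL \<Gamma>" and \<tau>: "\<tau> \<in> tangents \<Gamma> p"
  shows "outgoing_slope \<Gamma> (\<lambda>q\<in>points \<Gamma>. min (\<phi> q) c) \<tau> =
    (if \<phi> p < c then outgoing_slope \<Gamma> \<phi> \<tau>
     else if \<phi> p = c then min (outgoing_slope \<Gamma> \<phi> \<tau>) 0 else 0)"
proof -
  obtain e x \<sigma> where \<tau>_eq: "\<tau> = (e, x, \<sigma>)" by (cases \<tau>)
  define s where "s = outgoing_slope \<Gamma> \<phi> \<tau>"
  obtain \<delta> where \<delta>: "0 < \<delta>" "\<And>t. t \<in> {0..\<delta>} \<Longrightarrow> x + \<sigma> * t \<in> {0..len \<Gamma> e} \<and>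
    \<phi> (pt \<Gamma> e (x + \<sigma> * t)) = \<phi> p + of_int s * t"
    using PL_tangent_linear \<phi> \<tau> \<tau>_eq unfolding s_def by metis
  have e: "e \<in> edges \<Gamma>" using \<tau> \<tau>_eq by (auto simp: tangents_def)
  have val: "(\<lambda>q\<in>points \<Gamma>. min (\<phi> q) c) (pt \<Gamma> e (x + \<sigma> * t)) = min (\<phi> p + of_int s * t) c"
    if "t \<in> {0..\<delta>}" for t
    using \<delta>(2)[OF that] pt_in_points[OF \<Gamma> e] by simp
  show ?thesis
  proof (cases "\<phi> p = c")
    case True
    have "outgoing_slope \<Gamma> (\<lambda>q\<in>points \<Gamma>. min (\<phi> q) c) (e, x, \<sigma>) = min s 0"
    proof (rule outgoing_slope_eqI[OF \<delta>(1), of _ _ _ _ _ c])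
      fix t assume t: "t \<in> {0..\<delta>}"
      show "(\<lambda>q\<in>points \<Gamma>. min (\<phi> q) c) (pt \<Gamma> e (x + \<sigma> * t)) = c + of_int (min s 0) * t"
      proof (cases "0 \<le> s")
        case True
        then have "0 \<le> of_int s * t" using t by simp
        then show ?thesis using True \<open>\<phi> p = c\<close> unfolding val[OF t] by simp
      next
        case False
        then have "of_int s * t \<le> 0" using t by (simp add: mult_le_0_iff)
        then show ?thesis using t False \<open>\<phi> p = c\<close> unfolding val[OF t] by simp
      qed
    qed
    then show ?thesis using True \<tau>_eq s_def by simp
  next
    case False
    \<comment> \<open>Up to distance \<open>\<eta>\<close> the value changes by at most the gap
      between \<open>\<phi> p\<close> and \<open>c\<close>, so the same branch of the minimum stays
      active. The summand 1 prevents division by zero for slope 0.\<close>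
    define \<eta> where "\<eta> = min \<delta> (\<bar>\<phi> p - c\<bar> / (\<bar>of_int s\<bar> + 1))"
    have "0 < \<eta>" using \<delta>(1) False by (simp add: \<eta>_def)
    have small: "\<bar>of_int s * t\<bar> \<le> \<bar>\<phi> p - c\<bar>" if "t \<in> {0..\<eta>}" for t
    proof -
      have "t \<le> \<bar>\<phi> p - c\<bar> / (\<bar>of_int s\<bar> + 1)" using that by (simp add: \<eta>_def)
      then have "(\<bar>of_int s\<bar> + 1) * t \<le> \<bar>\<phi> p - c\<bar>" by (simp add: field_simps)
      moreover have "\<bar>of_int s * t\<bar> = \<bar>of_int s\<bar> * t" using that by (simp add: abs_mult)
      ultimately show ?thesis using that by (simp add: algebra_simps)
    qed
    show ?thesis
    proof (cases "\<phi> p < c")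
      case True
      have "outgoing_slope \<Gamma> (\<lambda>q\<in>points \<Gamma>. min (\<phi> q) c) (e, x, \<sigma>) = s"
      proof (rule outgoing_slope_eqI[OF \<open>0 < \<eta>\<close>, of _ _ _ _ _ "\<phi> p"])
        fix t assume t: "t \<in> {0..\<eta>}"
        then have "t \<in> {0..\<delta>}" by (simp add: \<eta>_def)
        from val[OF this] small[OF t] True
        show "(\<lambda>q\<in>points \<Gamma>. min (\<phi> q) c) (pt \<Gamma> e (x + \<sigma> * t)) = \<phi> p + of_int s * t"
          by simp
      qed
      then show ?thesis using True \<tau>_eq s_def by simp
    next
      case False
      have "outgoing_slope \<Gamma> (\<lambda>q\<in>points \<Gamma>. min (\<phi> q) c) (e, x, \<sigma>) = 0"
      proof (rule outgoing_slope_eqI[OF \<open>0 < \<eta>\<close>, of _ _ _ _ _ c])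
        fix t assume t: "t \<in> {0..\<eta>}"
        then have "t \<in> {0..\<delta>}" by (simp add: \<eta>_def)
        from val[OF this] small[OF t] False
        show "(\<lambda>q\<in>points \<Gamma>. min (\<phi> q) c) (pt \<Gamma> e (x + \<sigma> * t)) = c + of_int 0 * t"
          by simp
      qed
      then show ?thesis using False \<open>\<phi> p \<noteq> c\<close> \<tau>_eq s_def by simp
    qed
  qed
qed

section \<open>Chips moving away from the minimum\<close>

text \<open>Meaningful only while the coordinate stays in the edge. A tangent direction does not
  store its base point; \<open>along \<Gamma> \<tau> 0\<close> recovers it.\<close>

definition along :: "('v, 'e) metric_graph \<Rightarrow> 'e \<times> real \<times> real \<Rightarrow> real \<Rightarrow> ('v, 'e) point" where
  "along \<Gamma> = (\<lambda>(e, x, \<sigma>) t. pt \<Gamma> e (x + \<sigma> * t))"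

lemma along_0: "\<tau> \<in> tangents \<Gamma> p \<Longrightarrow> along \<Gamma> \<tau> 0 = p"
  by (auto simp: along_def tangents_def)

text \<open>On a ray of slope \<open>k\<close> a rise by \<open>t\<close> is reached at distance
  \<open>t / k\<close>, whence this parametrisation.\<close>

lemma limitin_along:
  assumes \<Gamma>: "is_metric_graph \<Gamma>" and \<tau>: "\<tau> \<in> tangents \<Gamma> p" and "0 < k"
  shows "limitin (graph_topology \<Gamma>) (\<lambda>t. along \<Gamma> \<tau> (t / k)) p (at_right 0)"
proof -
  obtain e x \<sigma> where \<tau>_eq: "\<tau> = (e, x, \<sigma>)" by (cases \<tau>)
  with \<tau> have e: "e \<in> edges \<Gamma>" "x \<in> {0..len \<Gamma> e}" "pt \<Gamma> e x = p"
    and \<sigma>: "\<sigma> = 1 \<and> x < len \<Gamma> e \<or> \<sigma> = -1 \<and> 0 < x" by (auto simp: tangents_def)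
  have lim: "((\<lambda>t. x + \<sigma> * (t / k)) \<longlongrightarrow> x) (at_right 0)"
    using \<open>0 < k\<close> by (auto intro!: tendsto_eq_intros)
  have pos: "\<forall>\<^sub>F t::real in at_right 0. 0 < t"
    by (simp add: eventually_at_right_less)
  have "\<forall>\<^sub>F t in at_right 0. x + \<sigma> * (t / k) \<in> {0..len \<Gamma> e}"
    using \<sigma>
  proof (elim disjE conjE)
    assume "\<sigma> = 1" "x < len \<Gamma> e"
    from order_tendstoD(2)[OF lim this(2)] pos show ?thesis
      by eventually_elim (use \<open>\<sigma> = 1\<close> \<open>0 < k\<close> e(2) in auto)
  next
    assume "\<sigma> = -1" "0 < x"
    from order_tendstoD(1)[OF lim this(2)] pos show ?thesis
    proof eventually_elim
      case (elim t)
      then have "0 < t / k" using \<open>0 < k\<close> by simp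
      with elim \<open>\<sigma> = -1\<close> e(2) show ?case by auto
    qed
  qed
  from limitin_pt[OF \<Gamma> e(1) this e(2) lim] show ?thesis
    by (simp add: \<tau>_eq along_def e(3))
qed

definition rising :: "('v, 'e) metric_graph \<Rightarrow> (('v, 'e) point \<Rightarrow> real) \<Rightarrow> ('e \<times> real \<times> real) set" where
  "rising \<Gamma> \<phi> = {\<tau>. \<exists>p\<in>argmin \<Gamma> \<phi>. \<tau> \<in> tangents \<Gamma> p \<and> 0 < outgoing_slope \<Gamma> \<phi> \<tau>}"

lemma argmin_value: "p \<in> argmin \<Gamma> \<phi> \<Longrightarrow> q \<in> argmin \<Gamma> \<phi> \<Longrightarrow> \<phi> p = \<phi> q"
  by (simp add: argmin_def order_antisym)

text \<open>At a minimum no outgoing slope is negative, and zero slopes do not contribute, so only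
  rising directions are left in the sum.\<close>

lemma divisor_of_argmin:
  assumes \<Gamma>: "is_metric_graph \<Gamma>" and \<phi>: "\<phi> \<in> PL \<Gamma>" and p: "p \<in> argmin \<Gamma> \<phi>"
  shows "divisor_of \<Gamma> \<phi> p = - (\<Sum>\<tau> | \<tau> \<in> rising \<Gamma> \<phi> \<and> along \<Gamma> \<tau> 0 = p. outgoing_slope \<Gamma> \<phi> \<tau>)"
proof -
  have "{\<tau>. \<tau> \<in> rising \<Gamma> \<phi> \<and> along \<Gamma> \<tau> 0 = p} = {\<tau> \<in> tangents \<Gamma> p. 0 < outgoing_slope \<Gamma> \<phi> \<tau>}"
    using p by (auto simp: rising_def along_0)
  moreover have "(\<Sum>\<tau>\<in>tangents \<Gamma> p. outgoing_slope \<Gamma> \<phi> \<tau>) =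
      (\<Sum>\<tau> \<in> {\<tau> \<in> tangents \<Gamma> p. 0 < outgoing_slope \<Gamma> \<phi> \<tau>}. outgoing_slope \<Gamma> \<phi> \<tau>)"
    using argmin_slope_nonneg[OF \<Gamma> \<phi> p]
    by (intro sum.mono_neutral_right finite_tangents[OF \<Gamma>]) (force simp: not_less intro: antisym)+
  ultimately show ?thesis by (simp add: divisor_of_def)
qed

text \<open>A rising direction makes \<open>div(\<phi>)\<close> negative at a minimum point, and
  effectivity of \<open>D + div(\<phi>)\<close> forces \<open>D\<close> to compensate.\<close>

lemma rising_base_in_supp:
  assumes \<Gamma>: "is_metric_graph \<Gamma>" and \<phi>: "\<phi> \<in> R \<Gamma> D" and p: "p \<in> argmin \<Gamma> \<phi>"
    and \<tau>: "\<tau> \<in> tangents \<Gamma> p" "0 < outgoing_slope \<Gamma> \<phi> \<tau>"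
  shows "0 < D p"
proof -
  have \<phi>': "\<phi> \<in> PL \<Gamma>" using \<phi> by (simp add: R_def)
  have "outgoing_slope \<Gamma> \<phi> \<tau> \<le> (\<Sum>\<tau>\<in>tangents \<Gamma> p. outgoing_slope \<Gamma> \<phi> \<tau>)"
    using argmin_slope_nonneg[OF \<Gamma> \<phi>' p] \<tau> by (intro member_le_sum finite_tangents[OF \<Gamma>]) auto
  moreover have "0 \<le> D p + divisor_of \<Gamma> \<phi> p" using \<phi> by (simp add: R_def effective_def)
  ultimately show ?thesis using \<tau>(2) by (simp add: divisor_of_def)
qed

text \<open>The minimum set may contain whole segments, but rising directions can start only at the
  finitely many points of \<open>supp D\<close>.\<close>

lemma finite_rising:
  assumes \<Gamma>: "is_metric_graph \<Gamma>" and D: "D \<in> divisors \<Gamma>" and \<phi>: "\<phi> \<in> R \<Gamma> D"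
  shows "finite (rising \<Gamma> \<phi>)"
proof (rule finite_subset)
  show "rising \<Gamma> \<phi> \<subseteq> (\<Union>p\<in>supp D. tangents \<Gamma> p)"
  proof
    fix \<tau> assume "\<tau> \<in> rising \<Gamma> \<phi>"
    then obtain p where "p \<in> argmin \<Gamma> \<phi>" "\<tau> \<in> tangents \<Gamma> p" "0 < outgoing_slope \<Gamma> \<phi> \<tau>"
      by (auto simp: rising_def)
    with rising_base_in_supp[OF \<Gamma> \<phi> this] show "\<tau> \<in> (\<Union>p\<in>supp D. tangents \<Gamma> p)"
      by (intro UN_I[of p]) (simp_all add: supp_def)
  qed
  show "finite (\<Union>p\<in>supp D. tangents \<Gamma> p)"
    using D finite_tangents[OF \<Gamma>] by (auto simp: divisors_def)
qed

text \<open>Let \<open>\<mu> + \<epsilon>\<close> lie below every non-minimal value at a breakpoint.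
  A low non-minimal point is then interior to a linear piece, and the lower end of that piece is a
  breakpoint that can only be a minimum. The two slopes at the point are recorded because they yield
  both the divisor there and the uniqueness of the ray.\<close>

lemma low_points_on_rising_rays:
  assumes \<Gamma>: "is_metric_graph \<Gamma>" and \<phi>: "\<phi> \<in> PL \<Gamma>" and p0: "p0 \<in> argmin \<Gamma> \<phi>"
  defines "\<mu> \<equiv> \<phi> p0"
  shows "\<forall>\<^sub>F \<epsilon> in at_right 0. \<forall>p\<in>points \<Gamma>. \<mu> < \<phi> p \<and> \<phi> p \<le> \<mu> + \<epsilon> \<longrightarrow>
    (\<exists>e x y \<sigma> k. (e, x, \<sigma>) \<in> rising \<Gamma> \<phi> \<and> outgoing_slope \<Gamma> \<phi> (e, x, \<sigma>) = k \<and>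
       y = x + \<sigma> * ((\<phi> p - \<mu>) / of_int k) \<and> 0 < y \<and> y < len \<Gamma> e \<and> p = Inner e y \<and>
       outgoing_slope \<Gamma> \<phi> (e, y, \<sigma>) = k \<and> outgoing_slope \<Gamma> \<phi> (e, y, - \<sigma>) = - k)"
    (is "\<forall>\<^sub>F \<epsilon> in _. \<forall>p\<in>_. _ \<longrightarrow> ?ray p")
proof -
  have min: "\<mu> \<le> \<phi> q" if "q \<in> points \<Gamma>" for q
    using p0 that by (simp add: argmin_def \<mu>_def)
  have argmin: "q \<in> argmin \<Gamma> \<phi>" if "q \<in> points \<Gamma>" "\<phi> q \<le> \<mu>" for q
    using p0 that by (fastforce simp: argmin_def \<mu>_def)
  have edge: "\<forall>\<^sub>F \<epsilon> in at_right 0. \<forall>y\<in>{0..len \<Gamma> e}.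
      \<mu> < \<phi> (pt \<Gamma> e y) \<and> \<phi> (pt \<Gamma> e y) \<le> \<mu> + \<epsilon> \<longrightarrow> ?ray (pt \<Gamma> e y)" if e: "e \<in> edges \<Gamma>" for e
  proof -
    obtain b :: "nat \<Rightarrow> real" and n where b: "b 0 = 0" "b n = len \<Gamma> e"
      "\<And>i. i < n \<Longrightarrow> b i < b (Suc i)" "\<And>i. i \<le> n \<Longrightarrow> b i \<in> {0..len \<Gamma> e}"
      and lin: "\<And>i. i < n \<Longrightarrow> \<exists>m::int. \<forall>x\<in>{b i..b (Suc i)}. \<forall>y\<in>{b i..b (Suc i)}.
         \<phi> (pt \<Gamma> e y) = \<phi> (pt \<Gamma> e x) + of_int m * (y - x)"
      using PL_partition[OF \<phi> e] by metis
    have b_pt: "pt \<Gamma> e (b i) \<in> points \<Gamma>" if "i \<le> n" for i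
      using b(4)[OF that] by (rule pt_in_points[OF \<Gamma> e])
    have "\<forall>\<^sub>F \<epsilon> in at_right 0. \<phi> (pt \<Gamma> e (b i)) \<le> \<mu> \<or> \<mu> + \<epsilon> < \<phi> (pt \<Gamma> e (b i))" for i
    proof (cases "\<phi> (pt \<Gamma> e (b i)) \<le> \<mu>")
      case False
      then have "0 < \<phi> (pt \<Gamma> e (b i)) - \<mu>" by simp
      from eventually_at_right_real[OF this] show ?thesis by eventually_elim auto
    qed simp
    then have "\<forall>\<^sub>F \<epsilon> in at_right 0. \<forall>i\<in>{..n}. \<phi> (pt \<Gamma> e (b i)) \<le> \<mu> \<or> \<mu> + \<epsilon> < \<phi> (pt \<Gamma> e (b i))"
      by (intro eventually_ball_finite) auto
    then show ?thesis
    proof eventually_elim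
      case (elim \<epsilon>)
      show ?case
      proof (intro ballI impI)
        fix y assume y: "y \<in> {0..len \<Gamma> e}" and low: "\<mu> < \<phi> (pt \<Gamma> e y) \<and> \<phi> (pt \<Gamma> e y) \<le> \<mu> + \<epsilon>"
        define p where "p = pt \<Gamma> e y"
        have ne: "y \<noteq> b i" if "i \<le> n" for i
        proof
          assume "y = b i"
          with elim[rule_format, of i] that low show False by auto
        qed
        have "y \<in> {b 0..<b n}" using y b ne[of n] by auto
        then obtain i where i: "i < n" "b i \<le> y" "y < b (Suc i)"
          using strict_partition_piece(1)[of n b] b(3) by blast
        then have "b i < y" using ne[of i] by simp
        have "\<exists>m::int. \<forall>x\<in>{b i..b (Suc i)}. \<forall>y\<in>{b i..b (Suc i)}.
            \<phi> (pt \<Gamma> e y) = \<phi> (pt \<Gamma> e x) + of_int m * (y - x)" by (rule lin[OF i(1)])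
        then obtain m :: int where "\<forall>x\<in>{b i..b (Suc i)}. \<forall>y\<in>{b i..b (Suc i)}.
            \<phi> (pt \<Gamma> e y) = \<phi> (pt \<Gamma> e x) + of_int m * (y - x)" ..
        note m = this[rule_format]
        have in01: "0 \<le> b i" "b (Suc i) \<le> len \<Gamma> e" using b(4)[of i] b(4)[of "Suc i"] i(1) by auto
        have bi: "\<phi> (pt \<Gamma> e (b i)) = \<phi> p + of_int m * (b i - y)"
          and bSi: "\<phi> (pt \<Gamma> e (b (Suc i))) = \<phi> p + of_int m * (b (Suc i) - y)"
          unfolding p_def using m[of y "b i"] m[of y "b (Suc i)"] i by auto
        have right: "outgoing_slope \<Gamma> \<phi> (e, z, 1) = m" if "b i \<le> z" "z < b (Suc i)" for z
        proof (rule outgoing_slope_eqI[of "b (Suc i) - z" _ _ _ _ _ "\<phi> (pt \<Gamma> e z)"])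
          fix t assume "t \<in> {0..b (Suc i) - z}"
          then show "\<phi> (pt \<Gamma> e (z + 1 * t)) = \<phi> (pt \<Gamma> e z) + of_int m * t"
            using m[of z "z + t"] that by simp
        qed (use that in simp)
        have left: "outgoing_slope \<Gamma> \<phi> (e, z, -1) = - m" if "b i < z" "z \<le> b (Suc i)" for z
        proof (rule outgoing_slope_eqI[of "z - b i" _ _ _ _ _ "\<phi> (pt \<Gamma> e z)"])
          fix t assume "t \<in> {0..z - b i}"
          then show "\<phi> (pt \<Gamma> e (z + -1 * t)) = \<phi> (pt \<Gamma> e z) + of_int (- m) * t"
            using m[of z "z - t"] that by simp
        qed (use that in simp)
        \<comment> \<open>On a piece of slope 0 the breakpoint \<open>b i\<close> would share the
          low non-minimal value of \<open>p\<close>, which the choice of \<open>\<epsilon>\<close>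
          excludes.\<close>
        have m0: "m \<noteq> 0"
          using bi elim[rule_format, of i] i(1) low by (auto simp: p_def)
        have p_eq: "p = Inner e y" unfolding p_def
          using i \<open>b i < y\<close> in01 by (intro pt_Inner) auto
        have "?ray p"
        \<comment> \<open>The sign of the slope decides which end of the piece is the lower one, and
          hence the base of the ray: the left end here, the right end in the other case.\<close>
        proof (cases "0 < m")
          case True
          then have "0 < real_of_int m * (y - b i)" using \<open>b i < y\<close> by simp
          then have "\<phi> (pt \<Gamma> e (b i)) < \<phi> p" using bi by (simp add: algebra_simps)
          then have mu: "\<phi> (pt \<Gamma> e (b i)) \<le> \<mu>"
            using elim[rule_format, of i] i(1) low by (auto simp: p_def)
          have "\<phi> (pt \<Gamma> e (b i)) = \<mu>" using mu min[OF b_pt[of i]] i(1) by linarith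
          with bi True have y_eq: "y = b i + 1 * ((\<phi> p - \<mu>) / of_int m)" by (simp add: field_simps)
          have "(e, b i, 1) \<in> rising \<Gamma> \<phi>"
            unfolding rising_def using argmin[OF b_pt mu] i(1) right[of "b i"] b(3)[OF i(1)] True e in01
            by (auto simp: tangents_def)
          then show ?thesis using y_eq p_eq right[of "b i"] right[of y] left[of y] i \<open>b i < y\<close> in01 b(3)[OF i(1)]
            by (intro exI[of _ e] exI[of _ "b i"] exI[of _ y] exI[of _ "1::real"] exI[of _ m]) simp
        next
          case False
          with m0 have neg: "m < 0" by simp
          then have "real_of_int m * (b (Suc i) - y) < 0" using i(3) by (simp add: mult_neg_pos)
          then have "\<phi> (pt \<Gamma> e (b (Suc i))) < \<phi> p" using bSi by simp
          then have mu: "\<phi> (pt \<Gamma> e (b (Suc i))) \<le> \<mu>"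
            using elim[rule_format, of "Suc i"] i(1) low by (auto simp: p_def)
          have "\<phi> (pt \<Gamma> e (b (Suc i))) = \<mu>" using mu min[OF b_pt[of "Suc i"]] i(1) by linarith
          with bSi neg have y_eq: "y = b (Suc i) + -1 * ((\<phi> p - \<mu>) / of_int (- m))" by (simp add: field_simps)
          have "(e, b (Suc i), -1) \<in> rising \<Gamma> \<phi>"
            unfolding rising_def using argmin[OF b_pt mu] i(1) left[of "b (Suc i)"] b(3)[OF i(1)] neg e in01
            by (auto simp: tangents_def)
          then show ?thesis using y_eq p_eq left[of "b (Suc i)"] right[of y] left[of y] i \<open>b i < y\<close> in01 b(3)[OF i(1)]
            by (intro exI[of _ e] exI[of _ "b (Suc i)"] exI[of _ y] exI[of _ "-1::real"] exI[of _ "-m"]) simp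
        qed
        then show "?ray (pt \<Gamma> e y)" by (simp add: p_def)
      qed
    qed
  qed
  then have "\<forall>\<^sub>F \<epsilon> in at_right 0. \<forall>e\<in>edges \<Gamma>. \<forall>y\<in>{0..len \<Gamma> e}.
      \<mu> < \<phi> (pt \<Gamma> e y) \<and> \<phi> (pt \<Gamma> e y) \<le> \<mu> + \<epsilon> \<longrightarrow> ?ray (pt \<Gamma> e y)"
    by (intro eventually_ball_finite finite_edges[OF \<Gamma>]) blast
  then show ?thesis
  proof eventually_elim
    case (elim \<epsilon>)
    show ?case
    proof (intro ballI impI)
      fix p assume "p \<in> points \<Gamma>" "\<mu> < \<phi> p \<and> \<phi> p \<le> \<mu> + \<epsilon>"
      moreover from this(1) obtain e y where "e \<in> edges \<Gamma>" "y \<in> {0..len \<Gamma> e}" "p = pt \<Gamma> e y"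
        by (rule point_on_edge[OF \<Gamma>])
      ultimately show "?ray p" using elim by blast
    qed
  qed
qed

text \<open>Complements the previous lemma: each rising direction really reaches the level
  \<open>\<epsilon>\<close> above the minimum, inside its edge and before its slope changes.\<close>

lemma rising_ray_near_base:
  assumes \<Gamma>: "is_metric_graph \<Gamma>" and \<phi>: "\<phi> \<in> PL \<Gamma>" and p0: "p0 \<in> argmin \<Gamma> \<phi>"
    and \<tau>: "(e, x, \<sigma>) \<in> rising \<Gamma> \<phi>"
  defines "k \<equiv> outgoing_slope \<Gamma> \<phi> (e, x, \<sigma>)"
  shows "\<forall>\<^sub>F \<epsilon> in at_right 0. 0 < x + \<sigma> * (\<epsilon> / of_int k) \<and> x + \<sigma> * (\<epsilon> / of_int k) < len \<Gamma> e \<and>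
    \<phi> (along \<Gamma> (e, x, \<sigma>) (\<epsilon> / of_int k)) = \<phi> p0 + \<epsilon> \<and>
    outgoing_slope \<Gamma> \<phi> (e, x + \<sigma> * (\<epsilon> / of_int k), - \<sigma>) = - k"
proof -
  from \<tau> obtain p where p: "p \<in> argmin \<Gamma> \<phi>" and \<tau>': "(e, x, \<sigma>) \<in> tangents \<Gamma> p" and k: "0 < k"
    by (auto simp: rising_def k_def)
  obtain \<delta> where \<delta>: "0 < \<delta>" "\<And>t. t \<in> {0..\<delta>} \<Longrightarrow> x + \<sigma> * t \<in> {0..len \<Gamma> e} \<and>
    \<phi> (pt \<Gamma> e (x + \<sigma> * t)) = \<phi> p + of_int k * t"
    using PL_tangent_linear[OF \<phi> \<tau>'] unfolding k_def by metis
  have \<sigma>: "\<sigma> = 1 \<or> \<sigma> = -1" using \<tau>' by (auto simp: tangents_def)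
  \<comment> \<open>For \<open>\<epsilon>\<close> below this bound the distance
    \<open>\<epsilon> / k\<close> stays strictly below \<open>\<delta>\<close>, so the landing point
    is not an end of the edge.\<close>
  have "0 < \<delta> * of_int k" using \<delta>(1) k by simp
  from eventually_at_right_real[OF this] show ?thesis
  proof eventually_elim
    case (elim \<epsilon>)
    define t where "t = \<epsilon> / of_int k"
    have t: "0 < t" "t < \<delta>" using elim k by (auto simp: t_def field_simps)
    have "0 < x + \<sigma> * t \<and> x + \<sigma> * t < len \<Gamma> e"
      using \<delta>(2)[of 0] \<delta>(2)[of \<delta>] t \<delta>(1) \<sigma> by auto
    moreover have "\<phi> (along \<Gamma> (e, x, \<sigma>) t) = \<phi> p0 + \<epsilon>"
      using \<delta>(2)[of t] t k argmin_value[OF p p0] by (simp add: along_def t_def)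
    moreover have "outgoing_slope \<Gamma> \<phi> (e, x + \<sigma> * t, - \<sigma>) = - k"
    proof (rule outgoing_slope_eqI[OF t(1), of _ _ _ _ _ "\<phi> p + of_int k * t"])
      fix s assume "s \<in> {0..t}"
      then have "t - s \<in> {0..\<delta>}" using t by auto
      from \<delta>(2)[OF this]
      show "\<phi> (pt \<Gamma> e (x + \<sigma> * t + - \<sigma> * s)) = \<phi> p + of_int k * t + of_int (- k) * s"
        by (simp add: algebra_simps)
    qed
    ultimately show ?case by (simp add: t_def)
  qed
qed

text \<open>Four kinds of points occur. At a minimum the truncation is invisible and the chips of
  the rising directions leave. Strictly between the two levels the opposite slopes along the ray
  cancel. At the level \<open>\<phi> p0 + \<epsilon>\<close> the upward slope is cut to 0, and the
  remaining slope \<open>- s \<tau>\<close> deposits \<open>s \<tau>\<close> chips. Higher up the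
  truncation is locally constant.\<close>

lemma divisor_of_truncation:
  fixes \<Gamma> :: "('v, 'e) metric_graph"
  assumes \<Gamma>: "is_metric_graph \<Gamma>" and \<phi>: "\<phi> \<in> PL \<Gamma>" and p0: "p0 \<in> argmin \<Gamma> \<phi>"
    and fin: "finite (rising \<Gamma> \<phi>)"
  defines "s \<equiv> outgoing_slope \<Gamma> \<phi>" and "T \<equiv> rising \<Gamma> \<phi>"
    and "q \<equiv> \<lambda>\<epsilon> \<tau>. along \<Gamma> \<tau> (\<epsilon> / of_int (outgoing_slope \<Gamma> \<phi> \<tau>))"
  shows "\<forall>\<^sub>F \<epsilon> in at_right 0. inj_on (q \<epsilon>) T \<and>
    (\<forall>\<tau>\<in>T. \<phi> (q \<epsilon> \<tau>) = \<phi> p0 + \<epsilon> \<and>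
      (\<exists>e y. e \<in> edges \<Gamma> \<and> 0 < y \<and> y < len \<Gamma> e \<and> q \<epsilon> \<tau> = Inner e y)) \<and>
    (\<forall>p. divisor_of \<Gamma> (\<lambda>z\<in>points \<Gamma>. min (\<phi> z) (\<phi> p0 + \<epsilon>)) p =
      (\<Sum>\<tau>\<in>T. s \<tau> * of_bool (q \<epsilon> \<tau> = p)) - (\<Sum>\<tau>\<in>T. s \<tau> * of_bool (along \<Gamma> \<tau> 0 = p)))"
proof -
  define \<mu> where "\<mu> = \<phi> p0"
  \<comment> \<open>\<open>ray \<epsilon> p \<tau>\<close> says that \<open>p\<close> lies on the
    rising ray \<open>\<tau>\<close> at height \<open>\<epsilon>\<close> above the minimum, together
    with the slopes at \<open>p\<close> along the ray in both directions.\<close>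
  define ray where "ray \<epsilon> p \<tau> \<longleftrightarrow> (case \<tau> of (e, x, \<sigma>) \<Rightarrow> \<tau> \<in> T \<and>
      (\<exists>y. y = x + \<sigma> * (\<epsilon> / of_int (s \<tau>)) \<and> 0 < y \<and> y < len \<Gamma> e \<and> p = Inner e y \<and>
       s (e, y, \<sigma>) = s \<tau> \<and> s (e, y, - \<sigma>) = - s \<tau>))" for \<epsilon> and p :: "('v, 'e) point" and \<tau>
  have E1: "\<forall>\<^sub>F \<epsilon> in at_right 0. \<forall>p\<in>points \<Gamma>. \<mu> < \<phi> p \<and> \<phi> p \<le> \<mu> + \<epsilon> \<longrightarrow> (\<exists>\<tau>. ray (\<phi> p - \<mu>) p \<tau>)"
    using low_points_on_rising_rays[OF \<Gamma> \<phi> p0]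
  proof eventually_elim
    case (elim \<epsilon>)
    show ?case
    proof (intro ballI impI)
      fix p assume p: "p \<in> points \<Gamma>" "\<mu> < \<phi> p \<and> \<phi> p \<le> \<mu> + \<epsilon>"
      from elim[rule_format, OF p(1), folded \<mu>_def, OF p(2), folded s_def T_def] obtain e x y \<sigma> where
        "(e, x, \<sigma>) \<in> T" "y = x + \<sigma> * ((\<phi> p - \<mu>) / of_int (s (e, x, \<sigma>)))" "0 < y" "y < len \<Gamma> e"
        "p = Inner e y" "s (e, y, \<sigma>) = s (e, x, \<sigma>)" "s (e, y, - \<sigma>) = - s (e, x, \<sigma>)"
        by blast
      then have "ray (\<phi> p - \<mu>) p (e, x, \<sigma>)" unfolding ray_def prod.case by blast
      then show "\<exists>\<tau>. ray (\<phi> p - \<mu>) p \<tau>" ..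
    qed
  qed
  have "\<forall>\<^sub>F \<epsilon> in at_right 0. \<forall>\<tau>\<in>T. case \<tau> of (e, x, \<sigma>) \<Rightarrow>
      0 < x + \<sigma> * (\<epsilon> / of_int (s \<tau>)) \<and> x + \<sigma> * (\<epsilon> / of_int (s \<tau>)) < len \<Gamma> e \<and>
      \<phi> (q \<epsilon> \<tau>) = \<mu> + \<epsilon> \<and> s (e, x + \<sigma> * (\<epsilon> / of_int (s \<tau>)), - \<sigma>) = - s \<tau>"
  proof (rule eventually_ball_finite)
    show "\<forall>\<tau>\<in>T. \<forall>\<^sub>F \<epsilon> in at_right 0. case \<tau> of (e, x, \<sigma>) \<Rightarrow>
      0 < x + \<sigma> * (\<epsilon> / of_int (s \<tau>)) \<and> x + \<sigma> * (\<epsilon> / of_int (s \<tau>)) < len \<Gamma> e \<and>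
      \<phi> (q \<epsilon> \<tau>) = \<mu> + \<epsilon> \<and> s (e, x + \<sigma> * (\<epsilon> / of_int (s \<tau>)), - \<sigma>) = - s \<tau>"
    proof
      fix \<tau> assume "\<tau> \<in> T"
      obtain e x \<sigma> where \<tau>: "\<tau> = (e, x, \<sigma>)" by (cases \<tau>)
      show "\<forall>\<^sub>F \<epsilon> in at_right 0. case \<tau> of (e, x, \<sigma>) \<Rightarrow>
        0 < x + \<sigma> * (\<epsilon> / of_int (s \<tau>)) \<and> x + \<sigma> * (\<epsilon> / of_int (s \<tau>)) < len \<Gamma> e \<and>
        \<phi> (q \<epsilon> \<tau>) = \<mu> + \<epsilon> \<and> s (e, x + \<sigma> * (\<epsilon> / of_int (s \<tau>)), - \<sigma>) = - s \<tau>"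
        using rising_ray_near_base[OF \<Gamma> \<phi> p0, of e x \<sigma>] \<open>\<tau> \<in> T\<close>
        unfolding \<tau> s_def q_def \<mu>_def T_def prod.case by simp
    qed
  qed (use fin T_def in simp)
  moreover have "\<forall>\<^sub>F \<epsilon>::real in at_right 0. 0 < \<epsilon>" by (simp add: eventually_at_right_less)
  ultimately show ?thesis using E1
  proof eventually_elim
    case (elim \<epsilon>)
    note E1 = elim(3)[rule_format]
    have T: "\<bar>\<sigma>\<bar> = 1 \<and> e \<in> edges \<Gamma> \<and> 0 < s (e, x, \<sigma>)" if "(e, x, \<sigma>) \<in> T" for e x \<sigma>
      using that by (auto simp: T_def rising_def tangents_def s_def)
    have base: "along \<Gamma> \<tau> 0 \<in> argmin \<Gamma> \<phi>" if "\<tau> \<in> T" for \<tau>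
      using that by (auto simp: T_def rising_def along_0)
    have base\<mu>: "\<phi> (along \<Gamma> \<tau> 0) = \<mu>" if "\<tau> \<in> T" for \<tau>
      unfolding \<mu>_def by (rule argmin_value[OF base[OF that] p0])
    have E2: "0 < x + \<sigma> * (\<epsilon> / of_int (s (e, x, \<sigma>)))" "x + \<sigma> * (\<epsilon> / of_int (s (e, x, \<sigma>))) < len \<Gamma> e"
      "\<phi> (q \<epsilon> (e, x, \<sigma>)) = \<mu> + \<epsilon>"
      "s (e, x + \<sigma> * (\<epsilon> / of_int (s (e, x, \<sigma>))), - \<sigma>) = - s (e, x, \<sigma>)"
      "q \<epsilon> (e, x, \<sigma>) = Inner e (x + \<sigma> * (\<epsilon> / of_int (s (e, x, \<sigma>))))"
      if "(e, x, \<sigma>) \<in> T" for e x \<sigma>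
    proof -
      show 1: "0 < x + \<sigma> * (\<epsilon> / of_int (s (e, x, \<sigma>)))" "x + \<sigma> * (\<epsilon> / of_int (s (e, x, \<sigma>))) < len \<Gamma> e"
        "\<phi> (q \<epsilon> (e, x, \<sigma>)) = \<mu> + \<epsilon>"
        "s (e, x + \<sigma> * (\<epsilon> / of_int (s (e, x, \<sigma>))), - \<sigma>) = - s (e, x, \<sigma>)"
        using bspec[OF elim(1) that] unfolding prod.case by blast+
      show "q \<epsilon> (e, x, \<sigma>) = Inner e (x + \<sigma> * (\<epsilon> / of_int (s (e, x, \<sigma>))))"
        using pt_Inner[OF 1(1,2)] by (simp add: q_def along_def s_def)
    qed
    have q\<mu>: "\<phi> (q \<epsilon> \<tau>) = \<mu> + \<epsilon>" if "\<tau> \<in> T" for \<tau>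
      using E2(3) that by (cases \<tau>) auto
    have q_Inner: "\<exists>e y. e \<in> edges \<Gamma> \<and> 0 < y \<and> y < len \<Gamma> e \<and> q \<epsilon> \<tau> = Inner e y" if "\<tau> \<in> T" for \<tau>
    proof (cases \<tau>)
      case (fields e x \<sigma>)
      with that have "(e, x, \<sigma>) \<in> T" by simp
      from E2[OF this] T[OF this] fields show ?thesis by blast
    qed
    have q_pt: "q \<epsilon> \<tau> \<in> points \<Gamma>" if "\<tau> \<in> T" for \<tau>
      using q_Inner[OF that] by (auto simp: points_def)
    \<comment> \<open>Two rays meeting at a point both leave it backwards in the only direction in which \<open>\<phi>\<close> decreases.\<close>
    have uniq: "\<tau>' = \<tau>" if \<tau>: "\<tau> \<in> T" and r: "ray \<epsilon> (q \<epsilon> \<tau>) \<tau>'" for \<tau> \<tau>'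
    proof -
      obtain e x \<sigma> where \<tau>_eq: "\<tau> = (e, x, \<sigma>)" by (cases \<tau>)
      obtain e' x' \<sigma>' where \<tau>'_eq: "\<tau>' = (e', x', \<sigma>')" by (cases \<tau>')
      define y where "y = x + \<sigma> * (\<epsilon> / of_int (s \<tau>))"
      have \<tau>T: "(e, x, \<sigma>) \<in> T" using \<tau> \<tau>_eq by simp
      have left: "s (e, y, - \<sigma>) = - s \<tau>" and qy: "q \<epsilon> \<tau> = Inner e y"
        using E2(4,5)[OF \<tau>T] by (simp_all add: y_def \<tau>_eq)
      have \<tau>'T: "(e', x', \<sigma>') \<in> T" using r by (simp add: ray_def \<tau>'_eq)
      have y': "e' = e" "y = x' + \<sigma>' * (\<epsilon> / of_int (s \<tau>'))"
        "s (e, y, \<sigma>') = s \<tau>'" "s (e, y, - \<sigma>') = - s \<tau>'"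
        using r unfolding ray_def \<tau>'_eq qy prod.case by auto
      have "\<sigma>' \<noteq> - \<sigma>" using left y'(3) T[OF \<tau>T] T[OF \<tau>'T] \<tau>_eq \<tau>'_eq by auto
      then have "\<sigma>' = \<sigma>" using T[OF \<tau>T] T[OF \<tau>'T] by (auto simp: abs_if split: if_splits)
      with left y' have "s \<tau>' = s \<tau>" by simp
      with y' \<open>\<sigma>' = \<sigma>\<close> y_def have "x' = x" by simp
      with \<open>\<sigma>' = \<sigma>\<close> y' show ?thesis by (simp add: \<tau>_eq \<tau>'_eq)
    qed
    have inj: "inj_on (q \<epsilon>) T"
    proof (rule inj_onI)
      fix \<tau>1 \<tau>2 assume \<tau>: "\<tau>1 \<in> T" "\<tau>2 \<in> T" "q \<epsilon> \<tau>1 = q \<epsilon> \<tau>2"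
      \<comment> \<open>Both rays are compared with one ray through the common landing point, which
        exists because that point is low.\<close>
      have "\<exists>\<tau>'. ray (\<phi> (q \<epsilon> \<tau>1) - \<mu>) (q \<epsilon> \<tau>1) \<tau>'"
        using q\<mu>[OF \<tau>(1)] elim(2) by (intro E1[OF q_pt[OF \<tau>(1)]]) simp
      then obtain \<tau>' where ray: "ray \<epsilon> (q \<epsilon> \<tau>1) \<tau>'"
        unfolding q\<mu>[OF \<tau>(1)] by auto
      from uniq[OF \<tau>(1) this] uniq[OF \<tau>(2) ray[unfolded \<tau>(3)]] show "\<tau>1 = \<tau>2" by simp
    qed
    let ?\<psi> = "\<lambda>z\<in>points \<Gamma>. min (\<phi> z) (\<mu> + \<epsilon>)"
    have "divisor_of \<Gamma> ?\<psi> p =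
      (\<Sum>\<tau>\<in>T. s \<tau> * of_bool (q \<epsilon> \<tau> = p)) - (\<Sum>\<tau>\<in>T. s \<tau> * of_bool (along \<Gamma> \<tau> 0 = p))" for p
    proof (cases "p \<in> points \<Gamma>")
      case False
      \<comment> \<open>Off the graph both sides vanish: the slope sum is empty, and neither base
        nor landing points lie there.\<close>
      then have "tangents \<Gamma> p = {}" using pt_in_points[OF \<Gamma>] by (auto simp: tangents_def)
      moreover have "q \<epsilon> \<tau> \<noteq> p" "along \<Gamma> \<tau> 0 \<noteq> p" if "\<tau> \<in> T" for \<tau>
        using False q_pt[OF that] base[OF that] by (auto simp: argmin_def)
      ultimately show ?thesis by (simp add: divisor_of_def)
    next
      case p: True
      have slopes: "divisor_of \<Gamma> ?\<psi> p = - (\<Sum>\<tau>\<in>tangents \<Gamma> p.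
          if \<phi> p < \<mu> + \<epsilon> then s \<tau> else if \<phi> p = \<mu> + \<epsilon> then min (s \<tau>) 0 else 0)"
        unfolding divisor_of_def s_def
        by (intro arg_cong[where f = uminus] sum.cong refl) (rule outgoing_slope_truncation[OF \<Gamma> \<phi>])
      have q_sum_0: "(\<Sum>\<tau>\<in>T. s \<tau> * of_bool (q \<epsilon> \<tau> = p)) = 0" if "\<phi> p \<noteq> \<mu> + \<epsilon>"
      proof (intro sum.neutral ballI)
        fix \<tau> assume "\<tau> \<in> T"
        from q\<mu>[OF this] that have "q \<epsilon> \<tau> \<noteq> p" by blast
        then show "s \<tau> * of_bool (q \<epsilon> \<tau> = p) = 0" by simp
      qed
      have \<mu>_le: "\<mu> \<le> \<phi> p" using p0 p by (simp add: argmin_def \<mu>_def)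
      show ?thesis
      proof (cases "\<phi> p = \<mu>")
        case True
        then have pmin: "p \<in> argmin \<Gamma> \<phi>" using p0 p by (simp add: argmin_def \<mu>_def)
        have "divisor_of \<Gamma> ?\<psi> p = divisor_of \<Gamma> \<phi> p"
          using True elim(2) unfolding slopes unfolding divisor_of_def s_def by simp
        also have "\<dots> = - (\<Sum>\<tau>\<in>T. if along \<Gamma> \<tau> 0 = p then s \<tau> else 0)"
          using divisor_of_argmin[OF \<Gamma> \<phi> pmin] sum.inter_filter[of T s "\<lambda>\<tau>. along \<Gamma> \<tau> 0 = p"] fin
          by (simp add: T_def s_def)
        also have "\<dots> = - (\<Sum>\<tau>\<in>T. s \<tau> * of_bool (along \<Gamma> \<tau> 0 = p))"
          by (intro arg_cong[where f = uminus] sum.cong) auto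
        also have "(\<Sum>\<tau>\<in>T. s \<tau> * of_bool (q \<epsilon> \<tau> = p)) = 0"
          by (rule q_sum_0) (use True elim(2) in simp)
        ultimately show ?thesis by simp
      next
        case False
        with \<mu>_le have gt: "\<mu> < \<phi> p" by simp
        have 0: "(\<Sum>\<tau>\<in>T. s \<tau> * of_bool (along \<Gamma> \<tau> 0 = p)) = 0"
        proof (intro sum.neutral ballI)
          fix \<tau> assume "\<tau> \<in> T"
          from base\<mu>[OF this] False have "along \<Gamma> \<tau> 0 \<noteq> p" by blast
          then show "s \<tau> * of_bool (along \<Gamma> \<tau> 0 = p) = 0" by simp
        qed
        show ?thesis
        proof (cases "\<phi> p \<le> \<mu> + \<epsilon>")
          case True
          have "\<exists>\<tau>. ray (\<phi> p - \<mu>) p \<tau>" by (rule E1[OF p conjI[OF gt True]])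
          then obtain e x \<sigma> where ray: "ray (\<phi> p - \<mu>) p (e, x, \<sigma>)"
            unfolding split_paired_Ex by blast
          then have \<tau>T: "(e, x, \<sigma>) \<in> T" by (simp add: ray_def)
          from ray obtain y where y: "0 < y" "y < len \<Gamma> e" "p = Inner e y"
            "s (e, y, \<sigma>) = s (e, x, \<sigma>)" "s (e, y, - \<sigma>) = - s (e, x, \<sigma>)"
            "y = x + \<sigma> * ((\<phi> p - \<mu>) / of_int (s (e, x, \<sigma>)))" unfolding ray_def prod.case by blast
          have \<sigma>: "\<sigma> = 1 \<or> \<sigma> = -1" using T[OF \<tau>T] by (auto simp: abs_if split: if_splits)
          have tan: "tangents \<Gamma> p = {(e, y, \<sigma>), (e, y, - \<sigma>)}"
            using tangents_Inner[of e \<Gamma> y] T[OF \<tau>T] y(1-3) \<sigma> by auto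
          have ne: "(e, y, \<sigma>) \<noteq> (e, y, - \<sigma>)" using \<sigma> by auto
          show ?thesis
          proof (cases "\<phi> p = \<mu> + \<epsilon>")
            case False
            with True have "\<phi> p < \<mu> + \<epsilon>" by simp
            then show ?thesis using ne y(4,5) by (simp add: slopes 0 q_sum_0 tan)
          next
            case eq: True
            have "q \<epsilon> (e, x, \<sigma>) = p" using E2(5)[OF \<tau>T] y(3,6) eq by simp
            moreover have "(e, x, \<sigma>) = \<tau>" if "\<tau> \<in> T" "q \<epsilon> \<tau> = p" for \<tau>
              by (rule uniq[OF that(1)]) (use that(2) ray eq in simp)
            ultimately have "(q \<epsilon> \<tau> = p) = (\<tau> = (e, x, \<sigma>))" if "\<tau> \<in> T" for \<tau>
              using that by blast
            then have "(\<Sum>\<tau>\<in>T. s \<tau> * of_bool (q \<epsilon> \<tau> = p)) =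
                (\<Sum>\<tau>\<in>T. if \<tau> = (e, x, \<sigma>) then s \<tau> else 0)"
              by (intro sum.cong refl) simp
            also have "\<dots> = s (e, x, \<sigma>)" using \<tau>T fin by (simp add: T_def)
            finally show ?thesis using ne y(4,5) T[OF \<tau>T] eq by (simp add: slopes 0 tan)
          qed
        next
          case False
          then show ?thesis by (simp add: slopes 0 q_sum_0)
        qed
      qed
    qed
    with inj q\<mu> q_Inner show ?case unfolding \<mu>_def by simp
  qed
qed


section \<open>Convergence of divisors\<close>

text \<open>A pile of \<open>w k\<close> chips travelling along \<open>c k\<close> is lifted to
  \<open>w k\<close> equal coordinates of a tuple. The tuples converge coordinatewise, and the
  continuous quotient map carries the limit to divisors.\<close>

lemma eventually_Sym_topology:
  assumes \<Gamma>: "is_metric_graph \<Gamma>" and K: "finite K"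
    and lim: "\<And>k. k \<in> K \<Longrightarrow> limitin (graph_topology \<Gamma>) (c k) (l k) F"
    and U: "openin (Sym_topology \<Gamma> (sum w K)) U" "(\<lambda>p. \<Sum>k\<in>K. int (w k) * of_bool (l k = p)) \<in> U"
  shows "\<forall>\<^sub>F t in F. (\<lambda>p. \<Sum>k\<in>K. int (w k) * of_bool (c k t = p)) \<in> U"
proof -
  define d where "d = sum w K"
  let ?I = "SIGMA k:K. {..<w k}"
  have "finite ?I" "card ?I = d" using K by (auto simp: d_def)
  \<comment> \<open>Any enumeration of the labelled chips will do, since \<open>sum_divisor\<close>
    only counts coordinates.\<close>
  with ex_bij_betw_nat_finite[of ?I] obtain h where h: "bij_betw h {..<d} ?I"
    by (auto simp: atLeast0LessThan)
  define tuple where "tuple y = (\<lambda>j\<in>{..<d}. y (fst (h j)))" for y :: "_ \<Rightarrow> ('a, 'b) point"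
  have hK: "fst (h j) \<in> K" if "j < d" for j
    using bij_betwE[OF h, rule_format, of j] that by (auto simp: mem_Times_iff Sigma_def)
  have sum_tuple: "sum_divisor d (tuple y) = (\<lambda>p. \<Sum>k\<in>K. int (w k) * of_bool (y k = p))" for y
  proof
    fix p
    have "sum_divisor d (tuple y) p = int (card {j \<in> {..<d}. y (fst (h j)) = p})"
      unfolding sum_divisor_def tuple_def by (intro arg_cong[where f = "\<lambda>S. int (card S)"]) auto
    also have "\<dots> = (\<Sum>j<d. of_bool (y (fst (h j)) = p))"
      by (simp add: Collect_conj_eq lessThan_def)
    also have "\<dots> = (\<Sum>i\<in>?I. of_bool (y (fst i) = p))"
      by (rule sum.reindex_bij_betw[OF h])
    also have "\<dots> = (\<Sum>k\<in>K. \<Sum>j<w k. of_bool (y k = p))"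
      using K by (subst sum.Sigma) (auto simp only: case_prod_unfold finite_lessThan)
    also have "\<dots> = (\<Sum>k\<in>K. int (w k) * of_bool (y k = p))"
      by simp
    finally show "sum_divisor d (tuple y) p = (\<Sum>k\<in>K. int (w k) * of_bool (y k = p))" .
  qed
  have "limitin (product_topology (\<lambda>_. graph_topology \<Gamma>) {..<d}) (\<lambda>t. tuple (\<lambda>k. c k t)) (tuple l) F"
    unfolding limitin_componentwise
  proof (intro conjI ballI)
    show "tuple l \<in> extensional {..<d}" by (simp add: tuple_def)
    have "\<forall>\<^sub>F t in F. \<forall>k\<in>K. c k t \<in> topspace (graph_topology \<Gamma>)"
      using lim by (intro eventually_ball_finite K) (auto simp: limitin_def)
    then show "\<forall>\<^sub>F t in F. tuple (\<lambda>k. c k t) \<in> topspace (product_topology (\<lambda>_. graph_topology \<Gamma>) {..<d})"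
      by eventually_elim (use hK in \<open>auto simp: tuple_def\<close>)
    show "limitin (graph_topology \<Gamma>) (\<lambda>t. tuple (\<lambda>k. c k t) j) (tuple l j) F" if "j \<in> {..<d}" for j
      using lim[OF hK, of j] that by (simp add: tuple_def)
  qed
  from continuous_map_limit[OF quotient_imp_continuous_map[OF quotient_map_quotient_topology[where f = "sum_divisor d"]] this]
  have "limitin (Sym_topology \<Gamma> d) (\<lambda>t p. \<Sum>k\<in>K. int (w k) * of_bool (c k t = p))
      (\<lambda>p. \<Sum>k\<in>K. int (w k) * of_bool (l k = p)) F"
    by (simp add: o_def sum_tuple Sym_topology_def)
  then show ?thesis using U by (simp add: limitin_def d_def)
qed

text \<open>\<open>D\<close> is split into piles of \<open>s \<tau>\<close> chips that depart along
  the rising directions and a remainder that stays put. The same labelled piles describe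
  \<open>D\<close> at \<open>\<epsilon> = 0\<close> and the truncated divisor for small
  \<open>\<epsilon> > 0\<close>.\<close>

lemma eventually_truncation_in_open:
  assumes \<Gamma>: "is_metric_graph \<Gamma>" and D: "D \<in> divisors \<Gamma>" "effective D" and \<phi>: "\<phi> \<in> R \<Gamma> D"
    and p0: "p0 \<in> argmin \<Gamma> \<phi>" and U: "openin (Sym_topology \<Gamma> (nat (deg D))) U" "D \<in> U"
  shows "\<forall>\<^sub>F \<epsilon> in at_right 0.
    (\<lambda>p. D p + divisor_of \<Gamma> (\<lambda>z\<in>points \<Gamma>. min (\<phi> z) (\<phi> p0 + \<epsilon>)) p) \<in> U"
proof -
  define T where "T = rising \<Gamma> \<phi>"
  define s where "s = outgoing_slope \<Gamma> \<phi>"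
  \<comment> \<open>The number of chips leaving \<open>p\<close>.\<close>
  define B where "B p = (\<Sum>\<tau>\<in>T. s \<tau> * of_bool (along \<Gamma> \<tau> 0 = p))" for p
  have \<phi>': "\<phi> \<in> PL \<Gamma>" using \<phi> by (simp add: R_def)
  have finT: "finite T" unfolding T_def by (rule finite_rising[OF \<Gamma> D(1) \<phi>])
  have finD: "finite (supp D)" using D by (simp add: divisors_def)
  have s_pos: "0 < s \<tau>" if "\<tau> \<in> T" for \<tau> using that by (auto simp: T_def s_def rising_def)
  have base: "along \<Gamma> \<tau> 0 \<in> argmin \<Gamma> \<phi>" "along \<Gamma> \<tau> 0 \<in> supp D" "\<tau> \<in> tangents \<Gamma> (along \<Gamma> \<tau> 0)"
    if "\<tau> \<in> T" for \<tau>
  proof -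
    from that obtain p where p: "p \<in> argmin \<Gamma> \<phi>" "\<tau> \<in> tangents \<Gamma> p" "0 < outgoing_slope \<Gamma> \<phi> \<tau>"
      by (auto simp: T_def rising_def)
    with rising_base_in_supp[OF \<Gamma> \<phi> this] along_0[OF p(2)]
    show "along \<Gamma> \<tau> 0 \<in> argmin \<Gamma> \<phi>" "along \<Gamma> \<tau> 0 \<in> supp D" "\<tau> \<in> tangents \<Gamma> (along \<Gamma> \<tau> 0)"
      by (simp_all add: supp_def)
  qed
  have B_nonneg: "0 \<le> B p" for p
    unfolding B_def using s_pos by (intro sum_nonneg) (simp add: less_imp_le)
  have B_0: "B p = 0" if "p \<notin> argmin \<Gamma> \<phi> \<or> p \<notin> supp D" for p
    unfolding B_def using base that by (intro sum.neutral) auto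
  \<comment> \<open>The stationary piles must have nonnegative size. At a minimum point
    \<open>div(\<phi>)\<close> equals \<open>- B\<close>, so effectivity of
    \<open>D + div(\<phi>)\<close> gives the bound; elsewhere nothing leaves and \<open>D\<close>
    itself is effective.\<close>
  have B_le: "B p \<le> D p" for p
  proof (cases "p \<in> argmin \<Gamma> \<phi>")
    case True
    have "B p = (\<Sum>\<tau>\<in>T. if along \<Gamma> \<tau> 0 = p then s \<tau> else 0)"
      unfolding B_def by (intro sum.cong) auto
    then have "divisor_of \<Gamma> \<phi> p = - B p"
      using divisor_of_argmin[OF \<Gamma> \<phi>' True] sum.inter_filter[OF finT, of s "\<lambda>\<tau>. along \<Gamma> \<tau> 0 = p"]
      by (simp add: T_def s_def)
    moreover have "0 \<le> D p + divisor_of \<Gamma> \<phi> p" using \<phi> by (simp add: R_def effective_def)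
    ultimately show ?thesis by simp
  next
    case False
    then show ?thesis using B_0 D(2) by (simp add: effective_def)
  qed
  \<comment> \<open>Left summands label the moving piles, right summands the stationary
    ones.\<close>
  define K where "K = T <+> supp D"
  define w where "w = case_sum (\<lambda>\<tau>. nat (s \<tau>)) (\<lambda>p. nat (D p - B p))"
  define c where "c = (\<lambda>k \<epsilon>. case_sum (\<lambda>\<tau>. along \<Gamma> \<tau> (\<epsilon> / of_int (s \<tau>))) (\<lambda>p. p) k)"
  have finK: "finite K" unfolding K_def by (intro finite_Plus finT finD)
  have sum_K: "(\<Sum>k\<in>K. int (w k) * f k) = (\<Sum>\<tau>\<in>T. s \<tau> * f (Inl \<tau>)) + (\<Sum>p\<in>supp D. (D p - B p) * f (Inr p))" for f
  proof -
    have "(\<Sum>k\<in>K. int (w k) * f k) =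
        (\<Sum>\<tau>\<in>T. int (w (Inl \<tau>)) * f (Inl \<tau>)) + (\<Sum>p\<in>supp D. int (w (Inr p)) * f (Inr p))"
      unfolding K_def by (subst sum.Plus[OF finT finD]) simp
    also have "(\<Sum>\<tau>\<in>T. int (w (Inl \<tau>)) * f (Inl \<tau>)) = (\<Sum>\<tau>\<in>T. s \<tau> * f (Inl \<tau>))"
      using s_pos by (intro sum.cong) (simp_all add: w_def less_imp_le)
    also have "(\<Sum>p\<in>supp D. int (w (Inr p)) * f (Inr p)) = (\<Sum>p\<in>supp D. (D p - B p) * f (Inr p))"
      using B_le by (intro sum.cong) (simp_all add: w_def)
    finally show ?thesis .
  qed
  have chips: "(\<Sum>k\<in>K. int (w k) * of_bool (c k \<epsilon> = p)) =
      D p + (\<Sum>\<tau>\<in>T. s \<tau> * of_bool (along \<Gamma> \<tau> (\<epsilon> / of_int (s \<tau>)) = p)) - B p" for \<epsilon> p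
  proof -
    have "(\<Sum>r\<in>supp D. (D r - B r) * of_bool (r = p)) = (\<Sum>r\<in>supp D. if r = p then D r - B r else 0)"
      by (intro sum.cong) auto
    also have "\<dots> = D p - B p"
      using finD B_0[of p] by (simp add: supp_def)
    finally show ?thesis by (simp add: sum_K c_def)
  qed
  have c0: "(\<lambda>p. \<Sum>k\<in>K. int (w k) * of_bool (c k 0 = p)) = D"
    by (simp add: chips B_def)
  \<comment> \<open>Departing chips are counted once by base point and once by direction; this makes
    the total weight of all piles equal to \<open>deg D\<close>, as membership in the right
    symmetric power demands.\<close>
  have "(\<Sum>p\<in>supp D. B p) = (\<Sum>\<tau>\<in>T. s \<tau>)"
  proof -
    have "(\<Sum>p\<in>supp D. B p) = (\<Sum>\<tau>\<in>T. \<Sum>p\<in>supp D. s \<tau> * of_bool (along \<Gamma> \<tau> 0 = p))"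
      unfolding B_def by (rule sum.swap)
    also have "\<dots> = (\<Sum>\<tau>\<in>T. \<Sum>p\<in>supp D. if p = along \<Gamma> \<tau> 0 then s \<tau> else 0)"
      by (intro sum.cong) auto
    also have "\<dots> = (\<Sum>\<tau>\<in>T. s \<tau>)"
      using finD base by (intro sum.cong) simp_all
    finally show ?thesis .
  qed
  with sum_K[of "\<lambda>_. 1"] have "(\<Sum>k\<in>K. int (w k)) = deg D"
    by (simp add: deg_def sum_subtractf)
  then have "sum w K = nat (deg D)" by (simp flip: of_nat_sum)
  moreover have "limitin (graph_topology \<Gamma>) (c k) (c k 0) (at_right 0)" if "k \<in> K" for k
  proof (cases k)
    case (Inl \<tau>)
    then have "\<tau> \<in> T" using that by (auto simp: K_def)
    with limitin_along[OF \<Gamma> base(3), of \<tau> "of_int (s \<tau>)"] s_pos show ?thesis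
      by (simp add: c_def Inl)
  next
    case (Inr p)
    then have "p \<in> points \<Gamma>" using that D by (auto simp: K_def divisors_def)
    then show ?thesis
      using topspace_graph_topology[OF \<Gamma>] by (simp add: c_def Inr limitin_def)
  qed
  ultimately have "\<forall>\<^sub>F \<epsilon> in at_right 0. (\<lambda>p. \<Sum>k\<in>K. int (w k) * of_bool (c k \<epsilon> = p)) \<in> U"
    using eventually_Sym_topology[OF \<Gamma> finK, of c "\<lambda>k. c k 0" "at_right 0" w U] U c0 by simp
  with divisor_of_truncation[OF \<Gamma> \<phi>' p0 finT[unfolded T_def]] show ?thesis
  proof eventually_elim
    case (elim \<epsilon>)
    from elim(1) have "D p + divisor_of \<Gamma> (\<lambda>z\<in>points \<Gamma>. min (\<phi> z) (\<phi> p0 + \<epsilon>)) p =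
        (\<Sum>k\<in>K. int (w k) * of_bool (c k \<epsilon> = p))" for p
      unfolding chips B_def T_def s_def by simp
    with elim(2) show ?case by presburger
  qed
qed

section \<open>Isolated minima\<close>

text \<open>Along a direction of slope 0 the value stays minimal, so minimum points other than
  \<open>p\<close> would accumulate at \<open>p\<close>.\<close>

lemma tangents_at_isolated_min_rising:
  assumes \<Gamma>: "is_metric_graph \<Gamma>" and \<phi>: "\<phi> \<in> PL \<Gamma>"
    and p: "p \<in> isolated_points (graph_topology \<Gamma>) (argmin \<Gamma> \<phi>)" and \<tau>: "\<tau> \<in> tangents \<Gamma> p"
  shows "\<tau> \<in> rising \<Gamma> \<phi>"
proof -
  obtain e x \<sigma> where \<tau>_eq: "\<tau> = (e, x, \<sigma>)" by (cases \<tau>)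
  from p obtain U where pmin: "p \<in> argmin \<Gamma> \<phi>"
    and U: "openin (graph_topology \<Gamma>) U" "U \<inter> argmin \<Gamma> \<phi> = {p}"
    by (auto simp: isolated_points_def)
  have "outgoing_slope \<Gamma> \<phi> \<tau> \<noteq> 0"
  proof
    assume 0: "outgoing_slope \<Gamma> \<phi> \<tau> = 0"
    obtain \<delta> where \<delta>: "0 < \<delta>" "\<And>t. t \<in> {0..\<delta>} \<Longrightarrow> x + \<sigma> * t \<in> {0..len \<Gamma> e} \<and>
      \<phi> (pt \<Gamma> e (x + \<sigma> * t)) = \<phi> p + of_int (outgoing_slope \<Gamma> \<phi> (e, x, \<sigma>)) * t"
      using PL_tangent_linear[OF \<phi>] \<tau> \<tau>_eq by metis
    have e: "e \<in> edges \<Gamma>" "pt \<Gamma> e x = p" and \<sigma>: "\<sigma> = 1 \<or> \<sigma> = -1"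
      using \<tau> \<tau>_eq by (auto simp: tangents_def)
    have "\<forall>\<^sub>F t in at_right 0. along \<Gamma> \<tau> (t / 1) \<in> U"
      using limitin_along[OF \<Gamma> \<tau>, of 1] U by (auto simp: limitin_def)
    moreover have "\<forall>\<^sub>F t in at_right 0. t \<in> {0<..<\<delta>}"
      using eventually_at_right_real[OF \<delta>(1)] .
    ultimately have "\<forall>\<^sub>F t::real in at_right 0. False"
    proof eventually_elim
      case (elim t)
      let ?y = "x + \<sigma> * t"
      have y: "0 < ?y" "?y < len \<Gamma> e" using \<delta>(2)[of 0] \<delta>(2)[of \<delta>] elim(2) \<sigma> \<delta>(1) by auto
      have "\<phi> (pt \<Gamma> e ?y) = \<phi> p" using \<delta>(2)[of t] elim(2) 0 \<tau>_eq by simp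
      then have "pt \<Gamma> e ?y \<in> argmin \<Gamma> \<phi>"
        using pt_in_points[OF \<Gamma> e(1), of ?y] y pmin by (simp add: argmin_def)
      moreover have "pt \<Gamma> e ?y \<in> U" using elim(1) by (simp add: along_def \<tau>_eq)
      ultimately have "pt \<Gamma> e ?y = p" using U(2) by blast
      \<comment> \<open>An inner point has a single coordinate, so the nearby point cannot be
        \<open>p\<close> again, even on a loop.\<close>
      then have "pt \<Gamma> e x = Inner e ?y" using e(2) pt_Inner[OF y] by simp
      then have "\<sigma> * t = 0" unfolding pt_eq_Inner_iff by simp
      with \<sigma> elim(2) show False by auto
    qed
    then show False by simp
  qed
  moreover have "0 \<le> outgoing_slope \<Gamma> \<phi> \<tau>" by (rule argmin_slope_nonneg[OF \<Gamma> \<phi> pmin \<tau>])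
  ultimately show ?thesis using pmin \<tau> by (auto simp: rising_def)
qed

section \<open>Truncation above an isolated minimum against nondegeneracy\<close>

theorem proposition4p3:
  fixes \<Gamma> :: "('v, 'e) metric_graph"
    and D :: "('v, 'e) divisor"
    and \<Sigma> :: "(('v, 'e) point \<Rightarrow> real) set"
  assumes "is_metric_graph \<Gamma>"
    and "D \<in> divisors \<Gamma>"
    and "tropical_linear_series \<Gamma> D \<Sigma>"
    and "D \<in> linear_system \<Gamma> D \<Sigma>"
    and "nondegenerate \<Gamma> D \<Sigma> D"
  shows "\<forall>\<phi>\<in>\<Sigma>. isolated_points (graph_topology \<Gamma>) (argmin \<Gamma> \<phi>) = {}"
proof (rule ballI, rule ccontr)
  note \<Gamma> = \<open>is_metric_graph \<Gamma>\<close> and D = \<open>D \<in> divisors \<Gamma>\<close>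
  fix \<phi> assume \<phi>\<Sigma>: "\<phi> \<in> \<Sigma>" and "isolated_points (graph_topology \<Gamma>) (argmin \<Gamma> \<phi>) \<noteq> {}"
  then obtain p0 where p0_iso: "p0 \<in> isolated_points (graph_topology \<Gamma>) (argmin \<Gamma> \<phi>)" by blast
  then have p0: "p0 \<in> argmin \<Gamma> \<phi>" by (simp add: isolated_points_def)
  have sub: "\<Sigma> \<subseteq> R \<Gamma> D"
    and min_closed: "\<And>\<phi> \<psi>. \<phi> \<in> \<Sigma> \<Longrightarrow> \<psi> \<in> \<Sigma> \<Longrightarrow> (\<lambda>p\<in>points \<Gamma>. min (\<phi> p) (\<psi> p)) \<in> \<Sigma>"
    and add_closed: "\<And>\<phi> a. \<phi> \<in> \<Sigma> \<Longrightarrow> (\<lambda>p\<in>points \<Gamma>. \<phi> p + a) \<in> \<Sigma>"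
    using assms(3) by (auto simp: tropical_linear_series_def tropical_submodule_def)
  have \<phi>R: "\<phi> \<in> R \<Gamma> D" and \<phi>PL: "\<phi> \<in> PL \<Gamma>" using sub \<phi>\<Sigma> by (auto simp: R_def)
  obtain \<phi>0 where \<phi>0: "\<phi>0 \<in> \<Sigma>" "D = (\<lambda>p. D p + divisor_of \<Gamma> \<phi>0 p)"
    using assms(4) by (auto simp: linear_system_def)
  have div0: "divisor_of \<Gamma> \<phi>0 p = 0" for p using fun_cong[OF \<phi>0(2), of p] by simp
  \<comment> \<open>\<open>D\<close> is itself a member of its linear system, and all members are
    effective.\<close>
  have eff: "effective D" using \<phi>0 sub \<phi>0(2)[symmetric] by (auto simp: R_def)
  have "\<phi>0 \<in> PL \<Gamma>" using \<phi>0(1) sub by (auto simp: R_def)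
  from PL_constant_if_divisor_0[OF \<Gamma> this div0] obtain a where a: "\<And>p. p \<in> points \<Gamma> \<Longrightarrow> \<phi>0 p = a"
    by blast
  define \<psi> where "\<psi> \<epsilon> = (\<lambda>z\<in>points \<Gamma>. min (\<phi> z) (\<phi> p0 + \<epsilon>))" for \<epsilon>
  define E where "E \<epsilon> = (\<lambda>p. D p + divisor_of \<Gamma> (\<psi> \<epsilon>) p)" for \<epsilon>
  have "\<psi> \<epsilon> \<in> \<Sigma>" for \<epsilon>
  proof -
    \<comment> \<open>Shifting the constant function \<open>\<phi>0\<close> by this amount turns its
      value \<open>a\<close> into the cut-off level.\<close>
    have "(\<lambda>z\<in>points \<Gamma>. min (\<phi> z) ((\<lambda>p\<in>points \<Gamma>. \<phi>0 p + (\<phi> p0 + \<epsilon> - a)) z)) = \<psi> \<epsilon>"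
      unfolding \<psi>_def by (rule restrict_ext) (simp add: a)
    then show ?thesis using min_closed[OF \<phi>\<Sigma> add_closed[OF \<phi>0(1)]] by metis
  qed
  then have E_lin: "E \<epsilon> \<in> linear_system \<Gamma> D \<Sigma>" for \<epsilon>
    by (auto simp: linear_system_def E_def)
  have E_in: "\<forall>\<^sub>F \<epsilon> in at_right 0. E \<epsilon> \<in> U"
    if U: "openin (linear_system_topology \<Gamma> D \<Sigma>) U" "D \<in> U" for U
  proof -
    from U(1) obtain V where V: "openin (Sym_topology \<Gamma> (nat (deg D))) V" "U = V \<inter> linear_system \<Gamma> D \<Sigma>"
      by (auto simp: linear_system_topology_def openin_subtopology)
    with U(2) have "D \<in> V" by simp
    from eventually_truncation_in_open[OF \<Gamma> D eff \<phi>R p0 V(1) this] show ?thesis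
      by eventually_elim (use V(2) E_lin in \<open>simp add: E_def \<psi>_def\<close>)
  qed
  obtain U1 where U1: "openin (linear_system_topology \<Gamma> D \<Sigma>) U1" "D \<in> U1"
    "\<And>F. F \<in> U1 \<Longrightarrow> card (supp F) \<le> card (supp D)"
    using assms(5) by (auto simp: nondegenerate_def local_maximum_def)
  obtain U2 where U2: "openin (linear_system_topology \<Gamma> D \<Sigma>) U2" "D \<in> U2"
    "\<And>F. F \<in> U2 \<Longrightarrow> valence1_degree \<Gamma> D \<le> valence1_degree \<Gamma> F"
    using assms(5) by (auto simp: nondegenerate_def local_minimum_def)
  define T where "T = rising \<Gamma> \<phi>"
  define s where "s = outgoing_slope \<Gamma> \<phi>"
  define q where "q = (\<lambda>\<epsilon> \<tau>. along \<Gamma> \<tau> (\<epsilon> / of_int (s \<tau>)))"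
  define b where "b \<tau> = along \<Gamma> \<tau> 0" for \<tau>
  have finT: "finite T" unfolding T_def by (rule finite_rising[OF \<Gamma> D \<phi>R])
  have finD: "finite (supp D)" using D by (simp add: divisors_def)
  \<comment> \<open>The finitely many values of \<open>\<phi>\<close> on \<open>supp D\<close> are
    missed by all small levels, so every landing point is new to the support.\<close>
  have avoid: "\<forall>\<^sub>F \<epsilon> in at_right 0. \<forall>z\<in>supp D. \<phi> z \<noteq> \<phi> p0 + \<epsilon>"
  proof (intro eventually_ball_finite finD ballI)
    fix z
    show "\<forall>\<^sub>F \<epsilon> in at_right 0. \<phi> z \<noteq> \<phi> p0 + \<epsilon>"
    proof (cases "\<phi> z \<le> \<phi> p0")
      case True
      show ?thesis
        using eventually_at_right_less[of 0] by eventually_elim (use True in auto)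
    next
      case False
      then have "0 < \<phi> z - \<phi> p0" by simp
      from eventually_at_right_real[OF this] show ?thesis by eventually_elim auto
    qed
  qed
  have "\<forall>\<^sub>F \<epsilon> in at_right (0::real). 0 < \<epsilon>" by (rule eventually_at_right_less)
  with divisor_of_truncation[OF \<Gamma> \<phi>PL p0 finT[unfolded T_def]] avoid E_in[OF U1(1,2)] E_in[OF U2(1,2)]
  have "\<forall>\<^sub>F \<epsilon>::real in at_right 0. False"
  proof eventually_elim
    case (elim \<epsilon>)
    have inj: "inj_on (q \<epsilon>) T" and q\<mu>: "\<And>\<tau>. \<tau> \<in> T \<Longrightarrow> \<phi> (q \<epsilon> \<tau>) = \<phi> p0 + \<epsilon>"
      and q_Inner: "\<And>\<tau>. \<tau> \<in> T \<Longrightarrow> \<exists>e y. e \<in> edges \<Gamma> \<and> 0 < y \<and> y < len \<Gamma> e \<and> q \<epsilon> \<tau> = Inner e y"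
      and E_eq: "\<And>p. E \<epsilon> p = D p + (\<Sum>\<tau>\<in>T. s \<tau> * of_bool (q \<epsilon> \<tau> = p)) - (\<Sum>\<tau>\<in>T. s \<tau> * of_bool (b \<tau> = p))"
      using elim(1) by (simp_all add: E_def \<psi>_def q_def b_def s_def T_def)
    have T: "0 < s \<tau>" "b \<tau> \<in> argmin \<Gamma> \<phi>" if "\<tau> \<in> T" for \<tau>
      using that by (auto simp: T_def rising_def b_def s_def along_0)
    have b\<mu>: "\<phi> (b \<tau>) = \<phi> p0" if "\<tau> \<in> T" for \<tau> by (rule argmin_value[OF T(2)[OF that] p0])
    have sum_pos: "0 < (\<Sum>\<tau>\<in>T. s \<tau> * of_bool (f \<tau> = f \<tau>0))" if "\<tau>0 \<in> T" for f :: "_ \<Rightarrow> ('v, 'e) point" and \<tau>0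
      using that T by (intro sum_pos2[OF finT that]) (simp_all add: less_imp_le)
    have tan: "tangents \<Gamma> p0 \<subseteq> T"
      unfolding T_def using tangents_at_isolated_min_rising[OF \<Gamma> \<phi>PL p0_iso] by blast
    have p0_pt: "p0 \<in> points \<Gamma>" using p0 by (simp add: argmin_def)
    obtain \<tau>0 where \<tau>0: "\<tau>0 \<in> tangents \<Gamma> p0" using tangents_nonempty[OF \<Gamma> p0_pt] by blast
    show False
    proof (cases "valence \<Gamma> p0 = 1")
      case True
      let ?V = "{p \<in> points \<Gamma>. valence \<Gamma> p = 1}"
      \<comment> \<open>Landing points are inner points of valence 2, so no point of valence 1 gains
        chips, whereas \<open>p0\<close> loses some along its only direction.\<close>
      have q_V: "(\<Sum>\<tau>\<in>T. s \<tau> * of_bool (q \<epsilon> \<tau> = p)) = 0" if "p \<in> ?V" for p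
      proof (intro sum.neutral ballI)
        fix \<tau> assume "\<tau> \<in> T"
        from q_Inner[OF this] that have "q \<epsilon> \<tau> \<noteq> p" by (auto simp: valence_def tangents_Inner)
        then show "s \<tau> * of_bool (q \<epsilon> \<tau> = p) = 0" by simp
      qed
      have "0 \<le> (\<Sum>\<tau>\<in>T. s \<tau> * of_bool (b \<tau> = p))" for p
        using T by (intro sum_nonneg) (simp add: less_imp_le)
      then have "\<forall>p\<in>?V. E \<epsilon> p \<le> D p" using q_V by (simp add: E_eq)
      moreover have "E \<epsilon> p0 < D p0"
        using q_V[of p0] p0_pt True sum_pos[of \<tau>0 b] tan \<tau>0 by (auto simp: E_eq b_def along_0)
      ultimately have "valence1_degree \<Gamma> (E \<epsilon>) < valence1_degree \<Gamma> D"
        unfolding valence1_degree_def using p0_pt True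
        by (intro sum_strict_mono_ex1 finite_valence_1[OF \<Gamma>]) auto
      with U2(3)[OF elim(4)] show False by simp
    next
      case False
      \<comment> \<open>All base points are treated as if they were emptied. What surely remains in
        the support are its other points and the landing points, two disjoint sets.\<close>
      have disj: "(supp D - b ` T) \<inter> q \<epsilon> ` T = {}" using q\<mu> elim(2) by auto
      have "(supp D - b ` T) \<union> q \<epsilon> ` T \<subseteq> supp (E \<epsilon>)"
      proof
        fix p assume "p \<in> (supp D - b ` T) \<union> q \<epsilon> ` T"
        then consider "p \<in> supp D" "p \<notin> b ` T" "p \<notin> q \<epsilon> ` T" | \<tau> where "\<tau> \<in> T" "p = q \<epsilon> \<tau>"
          using disj by blast
        then show "p \<in> supp (E \<epsilon>)"
        proof cases
          case 1
          then have "(\<Sum>\<tau>\<in>T. s \<tau> * of_bool (q \<epsilon> \<tau> = p)) = 0" "(\<Sum>\<tau>\<in>T. s \<tau> * of_bool (b \<tau> = p)) = 0"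
            by (auto intro!: sum.neutral)
          with 1 show ?thesis by (simp add: supp_def E_eq)
        next
          case 2
          then have "b \<tau>' \<noteq> p" if "\<tau>' \<in> T" for \<tau>' using q\<mu>[OF 2(1)] b\<mu>[OF that] elim(5) by auto
          then have "(\<Sum>\<tau>\<in>T. s \<tau> * of_bool (b \<tau> = p)) = 0" by (auto intro!: sum.neutral)
          moreover have "p \<notin> supp D" using elim(2) q\<mu>[OF 2(1)] 2(2) by auto
          ultimately show ?thesis using sum_pos[OF 2(1), of "q \<epsilon>"] 2(2) by (simp add: supp_def E_eq)
        qed
      qed
      \<comment> \<open>Infinite sets have cardinality 0 by convention, so finiteness is required
        before comparing cardinalities.\<close>
      moreover have "finite (supp (E \<epsilon>))"
      proof (rule finite_subset)
        show "supp (E \<epsilon>) \<subseteq> supp D \<union> q \<epsilon> ` T \<union> b ` T"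
        proof
          fix p assume p: "p \<in> supp (E \<epsilon>)"
          show "p \<in> supp D \<union> q \<epsilon> ` T \<union> b ` T"
          proof (rule ccontr)
            assume "p \<notin> supp D \<union> q \<epsilon> ` T \<union> b ` T"
            then have "D p = 0" "(\<Sum>\<tau>\<in>T. s \<tau> * of_bool (q \<epsilon> \<tau> = p)) = 0"
              "(\<Sum>\<tau>\<in>T. s \<tau> * of_bool (b \<tau> = p)) = 0"
              by (auto intro!: sum.neutral simp: supp_def)
            with p show False by (simp add: supp_def E_eq)
          qed
        qed
      qed (use finD finT in auto)
      ultimately have "card ((supp D - b ` T) \<union> q \<epsilon> ` T) \<le> card (supp (E \<epsilon>))"
        by (rule card_mono[rotated])
      moreover have "card ((supp D - b ` T) \<union> q \<epsilon> ` T) = card (supp D - b ` T) + card T"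
        using disj finD finT card_image[OF inj] by (subst card_Un_disjoint) auto
      moreover have "card (supp D) - card (b ` T) \<le> card (supp D - b ` T)"
        using finT by (intro diff_card_le_card_Diff) simp
      \<comment> \<open>Two directions at \<open>p0\<close> share their base point, so there are
        strictly fewer base points than landing points. This is where the support gains a
        point.\<close>
      moreover have "card (b ` T) < card T"
      proof -
        have "\<not> inj_on b T"
        proof
          assume inj: "inj_on b T"
          have "\<tau> = \<tau>0" if "\<tau> \<in> tangents \<Gamma> p0" for \<tau>
            using inj_onD[OF inj, of \<tau> \<tau>0] that \<tau>0 tan along_0[OF that] along_0[OF \<tau>0] by (auto simp: b_def)
          with \<tau>0 have "tangents \<Gamma> p0 = {\<tau>0}" by blast
          with False show False by (simp add: valence_def)
        qed
        then show ?thesis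
          using card_image_le[OF finT, of b] eq_card_imp_inj_on[OF finT, of b] by force
      qed
      ultimately show False using U1(3)[OF elim(3)] by linarith
    qed
  qed
  then show False by simp
qed

end
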